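(* Let $Z = (Z(t))_{t\ge 0}$ and $H = (H(t))_{t \ge 0}$ be nonnegative, adapted processes with continuous paths, and assume that $\psi = (\psi(t))_{t \ge 0}$ is nonnegative and progressively measurable. Let $M = (M(t))_{t\ge 0}$ be a continuous local martingale starting at $0$. If $$ Z(t) \le \int_0^t \psi(s) Z(s)\,\mathrm{d}s + M(t) + H(t) $$ holds for all $t \ge 0$, then the following hold. (i) For $p \in (0,1)$ and $\mu,\nu>1$ such that $\frac 1\mu + \frac 1\nu = 1$ and $p\nu<1$, we have $$ \mathbf{E} \sup_{0 \le s \le t} Z^p(s) \le (c_{p\nu}+1)^{1/\nu}\, \Big(\mathbf{E}\exp\Big\{p\mu\int_0^t \psi(s)\,\mathrm{d}s\Big\}\Big)^{1/\mu}\, \Big(\mathbf{E} (H^*(t))^{p\nu}\Big)^{1/\nu}. $$ (ii) If $\psi$ is deterministic, then for $p \in (0,1)$ $$ \mathbf{E} \sup_{0 \le s \le t} Z^p(s) \le (c_p+1)\, \exp\Big\{p\int_0^t \psi(s)\,\mathrm{d}s\Big\}\, \mathbf{E} (H^*(t))^p, $$ and $$ \mathbf{E} Z(t) \le \exp\Big\{\int_0^t \psi(s)\,\mathrm{d}s\Big\}\, \mathbf{E} H^*(t). $$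
   Context: All processes are real-valued, indexed by $t\ge 0$, and defined on a common filtered probability space; "adapted", "progressively measurable" and "local martingale" refer to its filtration, and $\mathbf{E}$ denotes expectation. The inequalities in the conclusion are for $t\ge 0$. For a real-valued process $Y$, the running supremum is $Y^*(t) := \sup_{0 \le s \le t} Y(s)$. For $q \in (0,1)$, $$ c_q := \Big(4\wedge \frac 1q\Big)\, \frac{\pi q}{\sin(\pi q)}, $$ where $a\wedge b$ denotes the minimum of $a$ and $b$.
   Formalization: Each bound is stated except when H*(t)=0 a.s. and the integral of ψ over [0,t] is not a.s. finite, where the right side is the indeterminate ∞·0; with 0·∞=0 the claim fails there (ψ(s)=1/s, Z(s)=s, M=H=0). *)

theory Defs
  imports "HOL-Probability.Probability"
begin

text \<open>
  Processes have type \<open>real \<Rightarrow> 'a \<Rightarrow> real\<close> and only their values at times \<open>t \<ge> 0\<close> matter.  A filtration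
  \<open>(F t)\<close> indexed by \<open>t \<ge> 0\<close> is represented by any of its monotone extensions to the real line, such
  as \<open>F (max 0 t)\<close>; the notions defined for processes use \<open>F t\<close> for \<open>t \<ge> 0\<close> only.  Neither completeness nor
  right-continuity of the filtration is assumed.
\<close>

locale filtered_prob_space = prob_space P + filtration "space P" F
  for P :: "'a measure" and F :: "real \<Rightarrow> 'a measure" +
  assumes subalgebra_F: "subalgebra P (F t)"

definition adapted :: "(real \<Rightarrow> 'a measure) \<Rightarrow> (real \<Rightarrow> 'a \<Rightarrow> real) \<Rightarrow> bool" where
  "adapted F X \<longleftrightarrow> (\<forall>t\<ge>0. X t \<in> borel_measurable (F t))"

definition progressively_measurable ::
  "(real \<Rightarrow> 'a measure) \<Rightarrow> (real \<Rightarrow> 'a \<Rightarrow> real) \<Rightarrow> bool" where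
  "progressively_measurable F X \<longleftrightarrow>
     (\<forall>t\<ge>0. (\<lambda>(s, \<omega>). X s \<omega>) \<in> borel_measurable (restrict_space borel {0..t} \<Otimes>\<^sub>M F t))"

definition continuous_paths :: "'a measure \<Rightarrow> (real \<Rightarrow> 'a \<Rightarrow> real) \<Rightarrow> bool" where
  "continuous_paths P X \<longleftrightarrow> (\<forall>\<omega>\<in>space P. continuous_on {0..} (\<lambda>t. X t \<omega>))"

definition nonneg_process :: "'a measure \<Rightarrow> (real \<Rightarrow> 'a \<Rightarrow> real) \<Rightarrow> bool" where
  "nonneg_process P X \<longleftrightarrow> (\<forall>\<omega>\<in>space P. \<forall>t\<ge>0. 0 \<le> X t \<omega>)"

definition martingale ::
  "'a measure \<Rightarrow> (real \<Rightarrow> 'a measure) \<Rightarrow> (real \<Rightarrow> 'a \<Rightarrow> real) \<Rightarrow> bool" where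
  "martingale P F X \<longleftrightarrow> adapted F X \<and> (\<forall>t\<ge>0. integrable P (X t)) \<and>
     (\<forall>s\<ge>0. \<forall>t\<ge>s. AE \<omega> in P. real_cond_exp P (F s) (X t) \<omega> = X s \<omega>)"

text \<open>
  The library's \<open>stopping_time F\<close> takes values in the index type of \<open>F\<close>, so it cannot be infinite;
  here the value \<open>\<infinity>\<close> is allowed.
\<close>

definition ext_stopping_time :: "(real \<Rightarrow> 'a measure) \<Rightarrow> ('a \<Rightarrow> ennreal) \<Rightarrow> bool" where
  "ext_stopping_time F \<tau> \<longleftrightarrow> (\<forall>t\<ge>0. Measurable.pred (F t) (\<lambda>\<omega>. \<tau> \<omega> \<le> ennreal t))"

definition stopped :: "(real \<Rightarrow> 'a \<Rightarrow> real) \<Rightarrow> ('a \<Rightarrow> ennreal) \<Rightarrow> real \<Rightarrow> 'a \<Rightarrow> real" where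
  "stopped X \<tau> t \<omega> = X (enn2real (min (ennreal t) (\<tau> \<omega>))) \<omega>"

text \<open>Localisation is applied to \<open>X\<close> itself, which is the usual notion for processes starting at \<open>0\<close>.\<close>

definition continuous_local_martingale ::
  "'a measure \<Rightarrow> (real \<Rightarrow> 'a measure) \<Rightarrow> (real \<Rightarrow> 'a \<Rightarrow> real) \<Rightarrow> bool" where
  "continuous_local_martingale P F X \<longleftrightarrow> adapted F X \<and> continuous_paths P X \<and>
     (\<exists>\<tau> :: nat \<Rightarrow> 'a \<Rightarrow> ennreal. (\<forall>n. ext_stopping_time F (\<tau> n)) \<and>
        (AE \<omega> in P. incseq (\<lambda>n. \<tau> n \<omega>) \<and> (\<lambda>n. \<tau> n \<omega>) \<longlonglongrightarrow> \<infinity>) \<and>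
        (\<forall>n. martingale P F (stopped X (\<tau> n))))"

definition running_sup :: "(real \<Rightarrow> 'a \<Rightarrow> real) \<Rightarrow> real \<Rightarrow> 'a \<Rightarrow> real" where
  "running_sup Y t \<omega> = (SUP s\<in>{0..t}. Y s \<omega>)"

definition gronwall_const :: "real \<Rightarrow> real" where
  "gronwall_const q = min 4 (1 / q) * (pi * q / sin (pi * q))"

text \<open>
  Expectations of nonnegative quantities are \<open>[0,\<infinity>]\<close>-valued, hence the exponential and the powers
  (used with positive exponent only) on \<open>[0,\<infinity>]\<close>.
\<close>

definition exp_ennreal :: "ennreal \<Rightarrow> ennreal" where
  "exp_ennreal x = (if x = \<infinity> then \<infinity> else ennreal (exp (enn2real x)))"

definition powr_ennreal :: "ennreal \<Rightarrow> real \<Rightarrow> ennreal" where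
  "powr_ennreal x a = (if x = \<infinity> then \<infinity> else ennreal (enn2real x powr a))"

definition time_integral :: "(real \<Rightarrow> real) \<Rightarrow> real \<Rightarrow> ennreal" where
  "time_integral f t = (\<integral>\<^sup>+ s\<in>{0..t}. ennreal (f s) \<partial>lborel)"

text \<open>
  The integral of \<open>\<psi>\<close> over \<open>[0,t]\<close> may be infinite.  In \<open>ennreal\<close> one has \<open>0 * \<infinity> = 0\<close>, and with this
  convention a bound of the form \<open>E exp (\<integral>\<psi>) * E (H\<^sup>*)\<close> fails when the integral is infinite and
  \<open>H = 0\<close>: take \<open>\<psi> s = 1 / s\<close>, \<open>Z s = s\<close>, \<open>M = 0\<close>.  The statement therefore leaves out the
  indeterminate case in which \<open>H\<^sup>*\<close> vanishes almost surely and the integral of \<open>\<psi>\<close> is not almost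
  surely finite.  All other cases, including \<open>0 * \<infinity>\<close> with an almost surely finite integral, are kept.
\<close>

end

theory Submission
  imports Defs
begin

text \<open>
  Write \<open>\<Psi> t\<close> for the time integral of \<open>\<psi>\<close>, \<open>X = exp (- \<Psi>) Z\<close> and \<open>A = H\<^sup>*\<close>.  The pathwise Gronwall argument gives
  \<open>X \<le> A + L\<close> with \<open>L = \<integral> exp (- \<Psi>) dM\<close>, and Lenglart's argument then bounds the tail of \<open>X\<^sup>*\<close>:
  \<open>c P (X\<^sup>* > c) \<le> E (min A c) + c P (A \<ge> c)\<close>.  Integrating this against \<open>p c powr (p - 2) dc\<close> gives
  \<open>E (X\<^sup>*)^p \<le> (1 / (1 - p) + 1) E A^p\<close>, and \<open>1 / (1 - p) \<le> c\<^sub>p\<close>, so no Burkholder-type inequality is needed;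
  for random \<open>\<psi>\<close> Hoelder's inequality removes the factor \<open>exp (p \<Psi>)\<close>.

  The stochastic integral \<open>L\<close> is never constructed.  It is replaced by the sums
  \<open>\<Sum>j. exp (- \<Psi> t\<^sub>j) (M t\<^sub>j\<^sub>+\<^sub>1 - M t\<^sub>j)\<close> over a grid, restricted to the \<open>j\<close> for which no level has been reached by time
  \<open>t\<^sub>j\<close>.  They have expectation zero by the martingale property alone, dominate \<open>X - A\<close> up to an arbitrarily small
  error when the mesh is small, and are bounded below up to one overshoot, which is uniformly integrable; so
  Fatou's lemma applies.
\<close>

section \<open>Pathwise Gronwall estimates\<close>

text \<open>The obstacle is that the pathwise estimate holds only in the limit of small mesh, at a
  speed depending on the path, whereas expectations vanish for a fixed grid. Passing to the limit
  needs lower bounds uniform in the mesh. In continuous time, stopping when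
  \<open>\<bar>M\<bar>\<close> reaches \<open>n\<close> would provide one; on a grid,
  \<open>M\<close> may be far beyond \<open>n\<close> by the time the crossing is noticed. Pushed
  forward to the final time by the submartingale property, the part of this overshoot beyond a
  threshold \<open>b\<close> is small uniformly in the grid, and vanishes as \<open>b\<close> grows.

  Crossings are tested at grid times and weights are taken at left ends of cells, so each
  coefficient is known at the start of its cell. This suits a filtration without the usual
  conditions: no hitting time has to be shown to be a stopping time.

  Three levels are watched: \<open>n\<close> for \<open>\<bar>M\<bar>\<close> and a common level
  \<open>c\<close> for \<open>H\<close> and \<open>X\<close>. Until a crossing is noticed,
  \<open>H\<close> exceeds \<open>min A c\<close> by a small error at most. If \<open>A < c\<close>
  and \<open>n\<close> is large, only \<open>X\<close> can cross, and then \<open>X\<close> is close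
  to \<open>c\<close> when this is noticed.\<close>

lemma discrete_gronwall:
  fixes a u n :: "nat \<Rightarrow> real"
  assumes start: "a 0 = 1" "u 0 = 0" "n 0 = 0"
    and decr: "\<And>j. j < k \<Longrightarrow> a (Suc j) \<le> a j"
    and step: "\<And>j. j < k \<Longrightarrow> a (Suc j) * (u (Suc j) - u j) \<le> (a j - a (Suc j)) * (u j + n j + B + e)"
    and incr: "\<And>j. j < k \<Longrightarrow> \<bar>n (Suc j) - n j\<bar> \<le> e"
  shows "a k * (u k + n k + B) \<le> B + 2 * e * (1 - a k) + (\<Sum>j<k. a j * (n (Suc j) - n j))"
  using decr step incr
proof (induction k)
  case 0
  then show ?case by (simp add: start)
next
  case (Suc k)
  have IH: "a k * (u k + n k + B) \<le> B + 2 * e * (1 - a k) + (\<Sum>j<k. a j * (n (Suc j) - n j))"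
    using Suc by simp
  let ?d = "a k - a (Suc k)"
  \<comment> \<open>One \<open>e\<close> comes from \<open>step\<close>, the other from here: the
    increment of \<open>n\<close> is weighted by \<open>a k\<close> instead of
    \<open>a (Suc k)\<close>, which keeps the coefficient at the left end of the cell. Both errors
    are proportional to the drop of \<open>a\<close>, so they telescope to
    \<open>2 * e * (1 - a k)\<close> for any number of cells.\<close>
  have "?d * (n k - n (Suc k)) \<le> ?d * e"
    by (intro mult_left_mono) (use Suc.prems(1)[of k] Suc.prems(3)[of k] in auto)
  moreover have "a (Suc k) * (u (Suc k) - u k) \<le> ?d * (u k + n k + B + e)"
    using Suc.prems(2) by simp
  ultimately have "a (Suc k) * (u (Suc k) + n (Suc k) + B)
      \<le> a k * (u k + n k + B) + 2 * ?d * e + a k * (n (Suc k) - n k)"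
    by (simp add: algebra_simps)
  with IH show ?case by (simp add: algebra_simps)
qed

text \<open>A discrete product rule for \<open>exp (- \<Psi>) * (U + m + B)\<close>. The number
  \<open>K0\<close> is chosen before \<open>r\<close> because \<open>r\<close> will later be the
  grid time at which a crossing is noticed, and this time moves with \<open>K\<close>. That
  \<open>U\<close> is the integral of \<open>Z\<close> against \<open>\<Psi>\<close> enters through
  \<open>incr\<close>.\<close>

lemma pathwise_gronwall:
  fixes Z m U \<Psi> :: "real \<Rightarrow> real"
  assumes T: "0 \<le> T"
    and cont: "continuous_on {0..T} m" "continuous_on {0..T} U"
    and start: "U 0 = 0" "\<Psi> 0 = 0" "m 0 = 0"
    and nonneg: "\<And>s. 0 \<le> s \<Longrightarrow> s \<le> T \<Longrightarrow> 0 \<le> Z s"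
    and mono: "\<And>s t. 0 \<le> s \<Longrightarrow> s \<le> t \<Longrightarrow> t \<le> T \<Longrightarrow> \<Psi> s \<le> \<Psi> t"
    and incr: "\<And>s t C. 0 \<le> s \<Longrightarrow> s \<le> t \<Longrightarrow> t \<le> T \<Longrightarrow> (\<And>x. s \<le> x \<Longrightarrow> x \<le> t \<Longrightarrow> Z x \<le> C)
            \<Longrightarrow> U t - U s \<le> C * (\<Psi> t - \<Psi> s)"
    and e: "e > 0"
  shows "\<exists>K0>0. \<forall>K\<ge>K0. \<forall>r\<in>{0..T}. \<forall>B. (\<forall>s\<in>{0..r}. Z s \<le> U s + m s + B) \<longrightarrow>
     exp (- \<Psi> r) * Z r \<le> B + e + (\<Sum>j<K. exp (- \<Psi> (min (T * real j / real K) r)) *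
        (m (min (T * real (Suc j) / real K) r) - m (min (T * real j / real K) r)))"
proof -
  have "uniformly_continuous_on {0..T} m" "uniformly_continuous_on {0..T} (\<lambda>s. U s + m s)"
    by (intro compact_uniformly_continuous continuous_intros cont compact_Icc)+
  then obtain d1 d2 where d1: "d1 > 0"
      "\<And>s t. s \<in> {0..T} \<Longrightarrow> t \<in> {0..T} \<Longrightarrow> dist t s < d1 \<Longrightarrow> dist (m t) (m s) < e/2"
    and d2: "d2 > 0"
      "\<And>s t. s \<in> {0..T} \<Longrightarrow> t \<in> {0..T} \<Longrightarrow> dist t s < d2 \<Longrightarrow> dist (U t + m t) (U s + m s) < e/2"
    unfolding uniformly_continuous_on_def using e by (metis half_gt_zero)
  define d where "d = min d1 d2"
  have d: "d > 0" using d1 d2 by (simp add: d_def)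
  obtain K0 :: nat where K0: "K0 > 0" "T / d < real K0"
    by (metis gr0I less_nat_zero_code not_less of_nat_0 order_less_le_trans reals_Archimedean2 divide_nonneg_pos T d not_le)
  show ?thesis
  proof (intro exI[of _ K0] conjI allI impI ballI)
    fix K r B
    assume K: "K \<ge> K0" and r: "r \<in> {0..T}" and Z: "\<forall>s\<in>{0..r}. Z s \<le> U s + m s + B"
    have Kpos: "K > 0" using K K0 by simp
    define x where "x j = min (T * real j / real K) r" for j :: nat
    have x0: "x 0 = 0" using r by (simp add: x_def)
    have xK: "x K = r" using r Kpos by (simp add: x_def)
    have xr: "0 \<le> x j" "x j \<le> r" for j using r T by (auto simp: x_def)
    have xmono: "x j \<le> x (Suc j)" for j
      unfolding x_def using T by (intro min.mono divide_right_mono mult_left_mono) auto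
    have "T / real K \<le> T / real K0" using K K0 T by (simp add: frac_le)
    also have "\<dots> < d" using K0 d by (simp add: field_simps)
    finally have mesh: "T / real K < d" .
    have xd: "x (Suc j) - x j < d" for j
    proof -
      have "T * real (Suc j) / real K = T * real j / real K + T / real K"
        by (simp add: add_divide_distrib distrib_left)
      moreover have "0 \<le> T / real K" using T by simp
      ultimately have "x (Suc j) - x j \<le> T / real K"
        unfolding x_def by (auto simp: min_def)
      with mesh show ?thesis by simp
    qed
    have dec: "exp (- \<Psi> (x (Suc j))) \<le> exp (- \<Psi> (x j))" for j
      using mono[OF _ xmono[of j]] xr[of j] xr[of "Suc j"] r by auto
    have main: "exp (- \<Psi> (x K)) * (U (x K) + m (x K) + B) \<le> B + 2 * (e/2) * (1 - exp (- \<Psi> (x K)))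
      + (\<Sum>j<K. exp (- \<Psi> (x j)) * (m (x (Suc j)) - m (x j)))"
    proof (rule discrete_gronwall[where a = "\<lambda>j. exp (- \<Psi> (x j))" and u = "\<lambda>j. U (x j)" and n = "\<lambda>j. m (x j)"])
      show "exp (- \<Psi> (x (Suc j))) * (U (x (Suc j)) - U (x j))
         \<le> (exp (- \<Psi> (x j)) - exp (- \<Psi> (x (Suc j)))) * (U (x j) + m (x j) + B + e/2)" for j
      proof -
        \<comment> \<open>A bound for \<open>Z\<close> on the whole cell by values at its left end:
          \<open>Z\<close> stays below \<open>U + m + B\<close>, and \<open>U + m\<close> varies by
          less than \<open>e/2\<close> on the cell.\<close>
        let ?C = "U (x j) + m (x j) + B + e/2"
        let ?D = "\<Psi> (x (Suc j)) - \<Psi> (x j)"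
        have "0 \<le> Z (x j)" using nonneg xr[of j] r by auto
        also have "\<dots> \<le> U (x j) + m (x j) + B" using Z xr[of j] by auto
        finally have C: "0 \<le> ?C" using e by simp
        have D: "0 \<le> ?D" using mono[OF _ xmono[of j]] xr[of j] xr[of "Suc j"] r by auto
        have "U (x (Suc j)) - U (x j) \<le> ?C * ?D"
        proof (rule incr)
          fix y assume y: "x j \<le> y" "y \<le> x (Suc j)"
          then have yr: "0 \<le> y" "y \<le> r" using xr[of j] xr[of "Suc j"] by auto
          have "dist (U y + m y) (U (x j) + m (x j)) < e/2"
            using y xd[of j] xr[of j] yr r by (intro d2) (auto simp: dist_real_def d_def)
          moreover have "Z y \<le> U y + m y + B" using Z yr by simp
          ultimately show "Z y \<le> ?C" unfolding dist_real_def by linarith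
        qed (use xr[of j] xr[of "Suc j"] xmono[of j] r in auto)
        then have "exp (- \<Psi> (x (Suc j))) * (U (x (Suc j)) - U (x j)) \<le> exp (- \<Psi> (x (Suc j))) * (?C * ?D)"
          by (intro mult_left_mono) auto
        also have "\<dots> = (exp (- \<Psi> (x (Suc j))) * ?D) * ?C" by simp
        \<comment> \<open>\<open>?D \<le> exp ?D - 1\<close> turns the increment of
          \<open>\<Psi>\<close> into the drop of \<open>exp (- \<Psi>)\<close>. It may be multiplied
          by \<open>?C\<close> because \<open>?C\<close> is nonnegative, which comes from
          \<open>Z\<close> being nonnegative.\<close>
        also have "\<dots> \<le> (exp (- \<Psi> (x (Suc j))) * (exp ?D - 1)) * ?C"
        proof -
          have "?D \<le> exp ?D - 1" using exp_ge_add_one_self[of ?D] by linarith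
          then show ?thesis using C by (intro mult_right_mono mult_left_mono) auto
        qed
        also have "exp (- \<Psi> (x (Suc j))) * (exp ?D - 1) = exp (- \<Psi> (x j)) - exp (- \<Psi> (x (Suc j)))"
          by (simp add: right_diff_distrib flip: exp_add)
        finally show ?thesis .
      qed
      show "\<bar>m (x (Suc j)) - m (x j)\<bar> \<le> e/2" for j
        using d1(2)[of "x j" "x (Suc j)"] xd[of j] xmono[of j] xr[of j] xr[of "Suc j"] r
        by (auto simp: dist_real_def d_def)
    qed (use start x0 dec in auto)
    have "exp (- \<Psi> r) * Z r \<le> exp (- \<Psi> r) * (U r + m r + B)"
      using Z r by (intro mult_left_mono) auto
    also have "\<dots> \<le> B + 2 * (e/2) * (1 - exp (- \<Psi> r)) + (\<Sum>j<K. exp (- \<Psi> (x j)) * (m (x (Suc j)) - m (x j)))"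
      using main by (simp add: xK)
    also have "2 * (e/2) * (1 - exp (- \<Psi> r)) \<le> e"
      using e by simp
    finally show "exp (- \<Psi> r) * Z r \<le> B + e + (\<Sum>j<K. exp (- \<Psi> (min (T * real j / real K) r)) *
        (m (min (T * real (Suc j) / real K) r) - m (min (T * real j / real K) r)))"
      by (simp add: x_def)
  qed (use K0 in auto)
qed

section \<open>Integrals along a single path\<close>

lemma time_integral_eq_integral:
  assumes f: "f \<in> borel_measurable (restrict_space borel {0..T})"
    and nonneg: "\<And>s. 0 \<le> s \<Longrightarrow> s \<le> T \<Longrightarrow> 0 \<le> f s"
    and fin: "time_integral f T < \<infinity>" and t: "t \<le> T"
  shows "f integrable_on {0..t}" "time_integral f t = ennreal (integral {0..t} f)"
proof -
  have set: "set_borel_measurable lborel {0..t} f"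
  proof -
    have "f \<in> borel_measurable (restrict_space borel {0..t})"
      using measurable_restrict_space_iff measurable_restrict_mono[OF f, of "{0..t}"] t by auto
    then show ?thesis
      by (simp add: set_borel_measurable_def borel_measurable_restrict_space_iff scaleR_conv_of_real)
  qed
  have "(\<integral>\<^sup>+ s. ennreal (norm (indicator {0..t} s *\<^sub>R f s)) \<partial>lborel) \<le> time_integral f T"
    unfolding time_integral_def using t nonneg
    by (intro nn_integral_mono) (auto simp: indicator_def)
  then have int: "set_integrable lborel {0..t} f"
    unfolding set_integrable_def using fin set
    by (intro integrableI_bounded) (auto simp: set_borel_measurable_def)
  show "f integrable_on {0..t}"
    using set_borel_integral_eq_integral(1)[OF int] .
  have "time_integral f t = ennreal (LINT s:{0..t}|lborel. f s)"
  proof -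
    have "time_integral f t = (\<integral>\<^sup>+ s. ennreal (indicator {0..t} s *\<^sub>R f s) \<partial>lborel)"
      unfolding time_integral_def by (intro nn_integral_cong) (auto simp: indicator_def)
    also have "\<dots> = ennreal (LINT s:{0..t}|lborel. f s)"
      using int t nonneg unfolding set_lebesgue_integral_def set_integrable_def
      by (intro nn_integral_eq_integral) (auto simp: indicator_def)
    finally show ?thesis .
  qed
  then show "time_integral f t = ennreal (integral {0..t} f)"
    by (simp add: set_borel_integral_eq_integral(2)[OF int])
qed

lemma time_integral_product:
  assumes f: "f \<in> borel_measurable (restrict_space borel {0..T})"
    and nonneg: "\<And>s. 0 \<le> s \<Longrightarrow> s \<le> T \<Longrightarrow> 0 \<le> f s"
    and fin: "time_integral f T < \<infinity>" 
    and z: "continuous_on {0..T} z" "\<And>s. 0 \<le> s \<Longrightarrow> s \<le> T \<Longrightarrow> 0 \<le> z s"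
  shows "time_integral (\<lambda>s. f s * z s) T < \<infinity>"
    "(\<lambda>s. f s * z s) \<in> borel_measurable (restrict_space borel {0..T})"
proof -
  have zm: "z \<in> borel_measurable (restrict_space borel {0..T})"
    using borel_measurable_continuous_on_restrict[OF z(1)] by simp
  show "(\<lambda>s. f s * z s) \<in> borel_measurable (restrict_space borel {0..T})"
    using f zm by measurable
  have "bounded (z ` {0..T})" using z(1) by (intro compact_imp_bounded compact_continuous_image) auto
  then obtain C where C: "C > 0" "\<And>s. s \<in> {0..T} \<Longrightarrow> norm (z s) \<le> C"
    by (metis bounded_pos imageI)
  have "time_integral (\<lambda>s. f s * z s) T \<le> (\<integral>\<^sup>+ s. ennreal C * (ennreal (f s) * indicator {0..T} s) \<partial>lborel)"
    unfolding time_integral_def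
  proof (intro nn_integral_mono)
    fix s show "ennreal (f s * z s) * indicator {0..T} s \<le> ennreal C * (ennreal (f s) * indicator {0..T} s)"
      using C(1) C(2)[of s] nonneg[of s] z(2)[of s]
      by (auto simp: indicator_def mult.commute[of C] mult_left_mono simp flip: ennreal_mult)
  qed
  also have "\<dots> = ennreal C * time_integral f T"
    unfolding time_integral_def
  proof (rule nn_integral_cmult)
    have "(\<lambda>s. f s * indicator {0..T} s) \<in> borel_measurable lborel"
      using f by (simp add: borel_measurable_restrict_space_iff mult.commute)
    then have "(\<lambda>s. ennreal (f s * indicator {0..T} s)) \<in> borel_measurable lborel" by measurable
    also have "(\<lambda>s. ennreal (f s * indicator {0..T} s)) = (\<lambda>s. ennreal (f s) * indicator {0..T} s)"
      by (auto simp: indicator_def)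
    finally show "(\<lambda>s. ennreal (f s) * indicator {0..T} s) \<in> borel_measurable lborel" .
  qed
  also have "\<dots> < \<infinity>" using fin by (simp add: ennreal_mult_less_top)
  finally show "time_integral (\<lambda>s. f s * z s) T < \<infinity>" .
qed

text \<open>On a path with finite integral up to \<open>T\<close>, the conversions by
  \<open>enn2real\<close> lose nothing on \<open>{0..T}\<close>; the last item records this for
  \<open>U\<close>. Henstock-Kurzweil integrals supply continuity in the endpoint and additivity
  over adjacent intervals, and with the latter the increment bound is monotonicity of the
  integral.\<close>

lemma path_integrals:
  fixes f z :: "real \<Rightarrow> real"
  defines "\<Psi> \<equiv> \<lambda>t. enn2real (time_integral f t)"
    and "U \<equiv> \<lambda>t. enn2real (time_integral (\<lambda>s. f s * z s) t)"
  assumes T: "0 \<le> T" and f: "f \<in> borel_measurable (restrict_space borel {0..T})"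
    and nonneg: "\<And>s. 0 \<le> s \<Longrightarrow> s \<le> T \<Longrightarrow> 0 \<le> f s"
    and fin: "time_integral f T < \<infinity>" 
    and z: "continuous_on {0..T} z" "\<And>s. 0 \<le> s \<Longrightarrow> s \<le> T \<Longrightarrow> 0 \<le> z s"
  shows "continuous_on {0..T} \<Psi>" "continuous_on {0..T} U" "\<Psi> 0 = 0" "U 0 = 0"
    "\<And>s t. 0 \<le> s \<Longrightarrow> s \<le> t \<Longrightarrow> t \<le> T \<Longrightarrow> \<Psi> s \<le> \<Psi> t"
    "\<And>s t C. 0 \<le> s \<Longrightarrow> s \<le> t \<Longrightarrow> t \<le> T \<Longrightarrow> (\<And>x. s \<le> x \<Longrightarrow> x \<le> t \<Longrightarrow> z x \<le> C)
       \<Longrightarrow> U t - U s \<le> C * (\<Psi> t - \<Psi> s)"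
    "\<And>t. 0 \<le> t \<Longrightarrow> t \<le> T \<Longrightarrow> time_integral (\<lambda>s. f s * z s) t = ennreal (U t)"
proof -
  note fz = time_integral_product[OF f nonneg fin z]
  have fz0: "0 \<le> f s * z s" if "0 \<le> s" "s \<le> T" for s using nonneg z(2) that by simp
  have I: "f integrable_on {0..t}" "time_integral f t = ennreal (integral {0..t} f)"
    "(\<lambda>s. f s * z s) integrable_on {0..t}"
    "time_integral (\<lambda>s. f s * z s) t = ennreal (integral {0..t} (\<lambda>s. f s * z s))" if "t \<le> T" for t
    using time_integral_eq_integral[OF f _ fin that] time_integral_eq_integral[OF fz(2) _ fz(1) that]
      nonneg fz0 by blast+
  have \<Psi>: "\<Psi> t = integral {0..t} f" if "0 \<le> t" "t \<le> T" for t
  proof -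
    have "0 \<le> integral {0..t} f" using that nonneg by (intro integral_nonneg I(1)) auto
    then show ?thesis unfolding \<Psi>_def using that by (simp add: I(2))
  qed
  have U: "U t = integral {0..t} (\<lambda>s. f s * z s)" "time_integral (\<lambda>s. f s * z s) t = ennreal (U t)"
    if "0 \<le> t" "t \<le> T" for t
  proof -
    have "0 \<le> integral {0..t} (\<lambda>s. f s * z s)" using that fz0 by (intro integral_nonneg I(3)) auto
    then show "U t = integral {0..t} (\<lambda>s. f s * z s)" "time_integral (\<lambda>s. f s * z s) t = ennreal (U t)"
      unfolding U_def using that by (simp_all add: I(4))
  qed
  show "continuous_on {0..T} \<Psi>" "continuous_on {0..T} U"
    using indefinite_integral_continuous_1[OF I(1)[of T]] indefinite_integral_continuous_1[OF I(3)[of T]]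
    by (auto simp: \<Psi> U cong: continuous_on_cong_simp)
  show "\<Psi> 0 = 0" "U 0 = 0" using \<Psi>[of 0] U[of 0] T by auto
  have diff: "\<Psi> t - \<Psi> s = integral {s..t} f" "U t - U s = integral {s..t} (\<lambda>s. f s * z s)"
     "f integrable_on {s..t}" "(\<lambda>s. f s * z s) integrable_on {s..t}"
    if "0 \<le> s" "s \<le> t" "t \<le> T" for s t
  proof -
    show "\<Psi> t - \<Psi> s = integral {s..t} f"
      using Henstock_Kurzweil_Integration.integral_combine[OF that(1,2) I(1)[OF that(3)]] that by (simp add: \<Psi>)
    show "U t - U s = integral {s..t} (\<lambda>s. f s * z s)"
      using Henstock_Kurzweil_Integration.integral_combine[OF that(1,2) I(3)[OF that(3)]] that by (simp add: U)
    show "f integrable_on {s..t}" "(\<lambda>s. f s * z s) integrable_on {s..t}"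
      using I(1,3)[OF that(3)] that by (auto intro: integrable_on_subinterval)
  qed
  show "\<Psi> s \<le> \<Psi> t" if "0 \<le> s" "s \<le> t" "t \<le> T" for s t
  proof -
    have "0 \<le> integral {s..t} f"
      by (intro integral_nonneg diff) (use that nonneg in auto)
    then show ?thesis using diff(1)[OF that] by simp
  qed
  show "U t - U s \<le> C * (\<Psi> t - \<Psi> s)" 
    if st: "0 \<le> s" "s \<le> t" "t \<le> T" and C: "\<And>x. s \<le> x \<Longrightarrow> x \<le> t \<Longrightarrow> z x \<le> C" for s t C
  proof -
    have "integral {s..t} (\<lambda>s. f s * z s) \<le> integral {s..t} (\<lambda>s. C * f s)"
      using C nonneg st
      by (intro integral_le diff integrable_on_mult_right st) (auto simp: mult.commute[of C] mult_left_mono)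
    then show ?thesis using diff(1,2)[OF st] by simp
  qed
  show "time_integral (\<lambda>s. f s * z s) t = ennreal (U t)" if "0 \<le> t" "t \<le> T" for t
    using U(2) that .
qed

section \<open>Level sets and martingale increments\<close>

lemma le_of_rational_le:
  fixes f :: "real \<Rightarrow> real"
  assumes f: "continuous_on {0..t} f" and le: "\<And>q. q \<in> {0..t} \<inter> \<rat> \<Longrightarrow> f q \<le> c" and s: "s \<in> {0..t}"
  shows "f s \<le> c"
\<comment> \<open>Density of the rationals is used in the open interval, which is empty for
  \<open>t = 0\<close>; there the only point is itself rational.\<close>
proof (cases "t = 0")
  case True
  then show ?thesis using le[of 0] s by simp
next
  case False
  then have t: "0 < t" using s by simp
  have "{0<..<t} \<subseteq> closure ({0<..<t} \<inter> \<rat>)"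
    using open_Int_closure_subset[of "{0<..<t}" "\<rat>"] Rats_closure_real by simp
  also have "\<dots> \<subseteq> closure ({0..t} \<inter> \<rat>)" by (intro closure_mono) auto
  finally have "closure {0<..<t} \<subseteq> closure ({0..t} \<inter> \<rat>)" by (rule closure_minimal) simp
  moreover have "closure ({0..t} \<inter> \<rat>) \<subseteq> {0..t}" by (rule closure_minimal) auto
  ultimately have cl: "closure ({0..t} \<inter> \<rat>) = {0..t}" using t by auto
  show ?thesis
    by (rule continuous_le_on_closure[of "{0..t} \<inter> \<rat>" f s c]) (use cl f s le in auto)
qed

text \<open>
  On continuous paths this says \<open>Y s \<omega> < c\<close> for all \<open>s \<in> {0..t}\<close>.  The detour through rational times keeps it measurable
  also for \<open>exp (- \<Psi>) Z\<close>, whose paths may jump where \<open>\<Psi>\<close> becomes infinite.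
\<close>
definition strictly_below :: "(real \<Rightarrow> 'a \<Rightarrow> real) \<Rightarrow> real \<Rightarrow> real \<Rightarrow> 'a \<Rightarrow> bool" where
  "strictly_below Y c t \<omega> \<longleftrightarrow> (\<exists>k::nat. \<forall>q\<in>{0..t} \<inter> \<rat>. Y q \<omega> \<le> c - 1 / real (Suc k))"

lemma strictly_below_antimono:
  "strictly_below Y c t \<omega> \<Longrightarrow> s \<le> t \<Longrightarrow> strictly_below Y c s \<omega>"
  unfolding strictly_below_def by force

text \<open>The gap \<open>1 / real (Suc k)\<close> in the definition is what separates staying
  below \<open>c\<close> from reaching \<open>c\<close> at an irrational time. It exists on
  continuous paths because the maximum over a compact interval is attained.\<close>

lemma strictly_below_iff:
  assumes f: "continuous_on {0..t} (\<lambda>s. Y s \<omega>)" and t: "0 \<le> t"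
  shows "strictly_below Y c t \<omega> \<longleftrightarrow> (\<forall>s\<in>{0..t}. Y s \<omega> < c)"
proof
  assume "strictly_below Y c t \<omega>"
  then obtain k :: nat where k: "\<And>q. q \<in> {0..t} \<inter> \<rat> \<Longrightarrow> Y q \<omega> \<le> c - 1 / real (Suc k)"
    unfolding strictly_below_def by blast
  show "\<forall>s\<in>{0..t}. Y s \<omega> < c"
  proof
    fix s assume "s \<in> {0..t}"
    from le_of_rational_le[OF f k this] show "Y s \<omega> < c"
      by (smt (verit) divide_pos_pos of_nat_0_less_iff zero_less_Suc)
  qed
next
  assume *: "\<forall>s\<in>{0..t}. Y s \<omega> < c"
  obtain x where x: "x \<in> {0..t}" "\<forall>s\<in>{0..t}. Y s \<omega> \<le> Y x \<omega>"
    using continuous_attains_sup[of "{0..t}" "\<lambda>s. Y s \<omega>"] f t by auto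
  from * x have "0 < c - Y x \<omega>" by auto
  then obtain k :: nat where "inverse (real (Suc k)) < c - Y x \<omega>" using reals_Archimedean by blast
  then show "strictly_below Y c t \<omega>"
    unfolding strictly_below_def using x(2) by (intro exI[of _ k]) (force simp: inverse_eq_divide)
qed

text \<open>
  Summation by parts: only the value at the first exit from \<open>g\<close> escapes the bound \<open>n\<close>.
\<close>
lemma stopped_sum_lower_bound:
  fixes w N :: "nat \<Rightarrow> real"
  assumes w: "\<And>j. 0 \<le> w j" "\<And>j. w j \<le> 1" "\<And>j. j < k \<Longrightarrow> w (Suc j) \<le> w j"
    and g: "\<And>j. j < k \<Longrightarrow> g (Suc j) \<Longrightarrow> g j" and N: "\<And>j. j \<le> k \<Longrightarrow> g j \<Longrightarrow> \<bar>N j\<bar> \<le> n" and nb: "0 \<le> n" "0 \<le> b"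
  shows "- (2 * n + b) - (\<Sum>j<k. of_bool (g j \<and> \<not> g (Suc j) \<and> b < \<bar>N (Suc j)\<bar>) * \<bar>N (Suc j)\<bar>)
     \<le> (\<Sum>j<k. w j * of_bool (g j) * (N (Suc j) - N j))"
proof -
  define S where "S k = (\<Sum>j<k. w j * of_bool (g j) * (N (Suc j) - N j))" for k
  define q where "q j = of_bool (g j \<and> \<not> g (Suc j) \<and> b < \<bar>N (Suc j)\<bar>) * \<bar>N (Suc j)\<bar>" for j
  define Q where "Q k = (\<Sum>j<k. q j)" for k
  have S_Suc: "S (Suc k) = S k + w k * of_bool (g k) * (N (Suc k) - N k)" for k by (simp add: S_def)
  have Q_Suc: "Q (Suc k) = Q k + q k" for k by (simp add: Q_def)
  have q0: "0 \<le> q k" and Q0: "0 \<le> Q k" for k unfolding Q_def q_def by (auto intro!: sum_nonneg)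
  \<comment> \<open>Two invariants. The first lives while \<open>g\<close> holds:
    \<open>n * (1 - w k)\<close> pays for the decrease of the weights and the last \<open>n\<close>
    for the starting term. The second is weaker but survives the exit, after which \<open>S\<close>
    no longer changes; the exit value is paid by \<open>b\<close>, or by \<open>q k\<close> if it is
    larger than \<open>b\<close>.\<close>
  have "(g k \<longrightarrow> w k * N k - n * (1 - w k) - n \<le> S k) \<and> - (2 * n + b) - Q k \<le> S k"
    using w(3) g N
  proof (induction k)
    case 0
    have "w 0 * N 0 \<le> w 0 * n" if "g 0" using 0(3)[of 0] that w(1) by (intro mult_left_mono) auto
    moreover have "w 0 * n \<le> n" using w(2)[of 0] nb by (simp add: mult_left_le_one_le w(1))
    ultimately show ?case using nb by (auto simp: algebra_simps S_def Q_def)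
  next
    case (Suc k)
    have IH: "g k \<longrightarrow> w k * N k - n * (1 - w k) - n \<le> S k" "- (2 * n + b) - Q k \<le> S k"
      using Suc by auto
    show ?case
    proof (cases "g k")
      case False
      then have "\<not> g (Suc k)" using Suc.prems(2) by blast
      with False IH q0[of k] show ?thesis by (simp add: S_Suc Q_Suc)
    next
      case True
      have S: "w k * N (Suc k) - n * (1 - w k) - n \<le> S (Suc k)"
        using IH(1) True by (simp add: algebra_simps S_Suc)
      show ?thesis
      proof (cases "g (Suc k)")
        case g: True
        have Nk: "\<bar>N (Suc k)\<bar> \<le> n" using Suc.prems(3)[of "Suc k"] g by simp
        have "(w k - w (Suc k)) * (- n) \<le> (w k - w (Suc k)) * N (Suc k)"
          using Nk Suc.prems(1)[of k] by (intro mult_left_mono) auto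
        then have 1: "w (Suc k) * N (Suc k) - n * (1 - w (Suc k)) - n \<le> S (Suc k)"
          using S by (simp add: algebra_simps)
        have "w (Suc k) * (- n) \<le> w (Suc k) * N (Suc k)"
          using Nk w(1) by (intro mult_left_mono) auto
        then have "- (2 * n) \<le> S (Suc k)"
          using 1 by (simp add: algebra_simps)
        then show ?thesis using 1 Q0[of "Suc k"] nb by simp
      next
        case g: False
        have "w k * \<bar>N (Suc k)\<bar> \<le> \<bar>N (Suc k)\<bar>"
          by (intro mult_left_le_one_le w abs_ge_zero)
        moreover have "- \<bar>N (Suc k)\<bar> \<le> N (Suc k)" by linarith
        ultimately have "- \<bar>N (Suc k)\<bar> \<le> w k * N (Suc k)"
          using
            mult_left_mono[OF _ w(1)[of k], of "- \<bar>N (Suc k)\<bar>" "N (Suc k)"] by simp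
        moreover have "n * (1 - w k) \<le> n" using nb w(1)[of k] by (simp add: algebra_simps)
        moreover have "\<bar>N (Suc k)\<bar> \<le> b + q k" using True g nb by (simp add: q_def)
        ultimately have "- (2 * n + b) - q k \<le> S (Suc k)" using S by linarith
        then show ?thesis using g Q0[of k] by (simp add: Q_Suc)
      qed
    qed
  qed
  then show ?thesis by (simp add: S_def Q_def q_def)
qed

lemma sum_of_bool_exit_le_one:
  assumes "\<And>j. g (Suc j) \<Longrightarrow> g j"
  shows "(\<Sum>j<k. of_bool (g j \<and> \<not> g (Suc j)) :: real) \<le> 1"
proof -
  have "(\<Sum>j<k. of_bool (g j \<and> \<not> g (Suc j)) :: real) = (\<Sum>j<k. of_bool (g j) - of_bool (g (Suc j)))"
    using assms by (intro sum.cong) auto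
  also have "\<dots> = of_bool (g 0) - of_bool (g k)" by (rule sum_lessThan_telescope')
  finally show ?thesis by auto
qed

lemma integral_le_if_nn_integral_le:
  assumes "integrable M f" "(\<integral>\<^sup>+ x. ennreal (f x) \<partial>M) \<le> ennreal r" "0 \<le> r"
  shows "(\<integral> x. f x \<partial>M) \<le> (r::real)"
proof -
  have "(\<integral> x. f x \<partial>M) \<le> enn2real (\<integral>\<^sup>+ x. ennreal (f x) \<partial>M)"
    using assms(1) by (simp add: real_lebesgue_integral_def)
  also have "\<dots> \<le> r" using assms enn2real_leI by blast
  finally show ?thesis .
qed

section \<open>Measurability, and martingale increments with coefficients known in advance\<close>

context filtered_prob_space
begin

lemma subalgebra_F_mono: "s \<le> t \<Longrightarrow> subalgebra (F t) (F s)"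
  using sets_F_mono space_F by (auto simp: subalgebra_def)

lemma measurable_F_mono:
  "f \<in> measurable (F s) N \<Longrightarrow> s \<le> t \<Longrightarrow> f \<in> measurable (F t) N"
  by (rule measurable_from_subalg[OF subalgebra_F_mono])

lemma measurable_F_P: "f \<in> measurable (F s) N \<Longrightarrow> f \<in> measurable P N"
  by (rule measurable_from_subalg[OF subalgebra_F])

lemma sigma_finite_subalgebra_F: "sigma_finite_subalgebra P (F t)"
  by (intro finite_measure_subalgebra_is_sigma_finite finite_measure_subalgebra.intro
      finite_measure_subalgebra_axioms.intro subalgebra_F finite_measure_axioms)

lemma strictly_below_measurable:
  assumes "\<And>s. 0 \<le> s \<Longrightarrow> s \<le> t \<Longrightarrow> Y s \<in> borel_measurable (F s)"
  shows "Measurable.pred (F t) (strictly_below Y c t)"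
proof -
  have [measurable]: "Y q \<in> borel_measurable (F t)" if "q \<in> {0..t} \<inter> \<rat>" for q
    using assms[of q] that by (auto intro: measurable_F_mono)
  have [simp]: "countable ({0..t} \<inter> \<rat>)" using countable_rat by (rule countable_subset[rotated]) auto
  have "Measurable.pred (F t) (\<lambda>\<omega>. \<exists>k::nat. \<forall>q\<in>{0..t} \<inter> \<rat>. Y q \<omega> \<le> c - 1 / real (Suc k))"
  proof (intro pred_intros_countable measurable_pred_countable)
    fix q :: real and k :: nat assume "q \<in> {0..t} \<inter> \<rat>"
    then show "Measurable.pred (F t) (\<lambda>\<omega>. Y q \<omega> \<le> c - 1 / real (Suc k))" by measurable
  qed simp
  then show ?thesis by (simp add: strictly_below_def[abs_def])
qed

lemma time_integral_measurable:
  assumes \<psi>: "progressively_measurable F \<psi>" and t: "0 \<le> t"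
  shows "(\<lambda>\<omega>. time_integral (\<lambda>s. \<psi> s \<omega>) t) \<in> borel_measurable (F t)"
    "\<omega> \<in> space P \<Longrightarrow> (\<lambda>s. \<psi> s \<omega>) \<in> borel_measurable (restrict_space borel {0..t})"
proof -
  have m: "(\<lambda>(s, \<omega>). \<psi> s \<omega>) \<in> borel_measurable (restrict_space borel {0..t} \<Otimes>\<^sub>M F t)"
    using assms by (simp add: progressively_measurable_def)
  interpret L: sigma_finite_measure "restrict_space (lborel::real measure) {0..t}"
    by (rule sigma_finite_measure_restrict_space[OF sigma_finite_lborel]) simp
  have sets: "sets (restrict_space (lborel::real measure) {0..t}) = sets (restrict_space borel {0..t})"
    by (simp cong: sets_restrict_space_cong)
  have "(\<lambda>(\<omega>, s). ennreal (\<psi> s \<omega>)) \<in> borel_measurable (F t \<Otimes>\<^sub>M restrict_space lborel {0..t})"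
    using measurable_compose[OF measurable_compose[OF measurable_pair_swap' m] measurable_ennreal]
    by (simp add: case_prod_beta' cong: measurable_cong_sets sets_pair_measure_cong[OF refl sets])
  from L.borel_measurable_nn_integral[OF this]
  have "(\<lambda>\<omega>. \<integral>\<^sup>+ s. ennreal (\<psi> s \<omega>) \<partial>restrict_space lborel {0..t}) \<in> borel_measurable (F t)"
    by simp
  then show "(\<lambda>\<omega>. time_integral (\<lambda>s. \<psi> s \<omega>) t) \<in> borel_measurable (F t)"
    by (simp add: time_integral_def nn_integral_restrict_space)
  show "\<omega> \<in> space P \<Longrightarrow> (\<lambda>s. \<psi> s \<omega>) \<in> borel_measurable (restrict_space borel {0..t})"
    using measurable_compose[OF measurable_Pair2' m, of \<omega>] by (simp add: space_F)
qed

text \<open>A bounded factor known at time \<open>s\<close> is taken out of the conditional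
  expectation. All later uses of the martingale property go through this form.\<close>

lemma martingale_mult:
  assumes N: "martingale P F N" and st: "0 \<le> s" "s \<le> t"
    and h: "h \<in> borel_measurable (F s)" "\<And>\<omega>. \<bar>h \<omega>\<bar> \<le> C"
  shows "integrable P (\<lambda>\<omega>. h \<omega> * N t \<omega>)" "(\<integral> \<omega>. h \<omega> * N t \<omega> \<partial>P) = (\<integral> \<omega>. h \<omega> * N s \<omega> \<partial>P)"
proof -
  interpret sigma_finite_subalgebra P "F s" by (rule sigma_finite_subalgebra_F)
  have [measurable]: "h \<in> borel_measurable P" using h(1) by (rule measurable_F_P)
  have int: "integrable P (N t)" and [measurable]: "N s \<in> borel_measurable P" "N t \<in> borel_measurable P"
    and ce: "AE \<omega> in P. real_cond_exp P (F s) (N t) \<omega> = N s \<omega>"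
    using N st by (auto simp: martingale_def intro: borel_measurable_integrable)
  have Cpos: "0 \<le> C" using h(2)[of undefined] by simp
  show I: "integrable P (\<lambda>\<omega>. h \<omega> * N t \<omega>)"
  proof (rule Bochner_Integration.integrable_bound[of P "\<lambda>\<omega>. C * N t \<omega>"])
    show "AE \<omega> in P. norm (h \<omega> * N t \<omega>) \<le> norm (C * N t \<omega>)"
      using h(2) Cpos by (intro AE_I2) (simp add: abs_mult mult_right_mono)
  qed (use int in auto)
  have "(\<integral> \<omega>. h \<omega> * N t \<omega> \<partial>P) = (\<integral> \<omega>. h \<omega> * real_cond_exp P (F s) (N t) \<omega> \<partial>P)"
    using real_cond_exp_intg(2)[OF I h(1)] by simp
  also have "\<dots> = (\<integral> \<omega>. h \<omega> * N s \<omega> \<partial>P)"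
    using ce by (intro integral_cong_AE) auto
  finally show "(\<integral> \<omega>. h \<omega> * N t \<omega> \<partial>P) = (\<integral> \<omega>. h \<omega> * N s \<omega> \<partial>P)" .
qed

text \<open>The submartingale property of \<open>\<bar>N\<bar>\<close> without a conditional Jensen
  inequality: the bounded factor \<open>of_bool (B \<omega>) * sgn (N s \<omega>)\<close> turns
  \<open>N s\<close> into \<open>\<bar>N s\<bar>\<close> on \<open>B\<close>, and turns
  \<open>N t\<close> into something at most \<open>\<bar>N t\<bar>\<close> there.\<close>

lemma martingale_abs_mono:
  assumes N: "martingale P F N" and st: "0 \<le> s" "s \<le> t" and B: "Measurable.pred (F s) B"
  shows "(\<integral> \<omega>. of_bool (B \<omega>) * \<bar>N s \<omega>\<bar> \<partial>P) \<le> (\<integral> \<omega>. of_bool (B \<omega>) * \<bar>N t \<omega>\<bar> \<partial>P)"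
proof -
  let ?h = "\<lambda>\<omega>. of_bool (B \<omega>) * sgn (N s \<omega>)"
  have Ns: "N s \<in> borel_measurable (F s)" using N st by (auto simp: martingale_def adapted_def)
  have h: "?h \<in> borel_measurable (F s)" using B Ns by measurable
  have h1: "\<bar>?h \<omega>\<bar> \<le> 1" for \<omega> by (auto simp: sgn_if)
  have "Measurable.pred P B" using B by (rule measurable_F_P)
  note [measurable] = this
  have int: "integrable P (N t)" using N st by (auto simp: martingale_def)
  have "(\<integral> \<omega>. of_bool (B \<omega>) * \<bar>N s \<omega>\<bar> \<partial>P) = (\<integral> \<omega>. ?h \<omega> * N s \<omega> \<partial>P)"
    by (intro Bochner_Integration.integral_cong) (auto simp: abs_sgn)
  also have "\<dots> = (\<integral> \<omega>. ?h \<omega> * N t \<omega> \<partial>P)"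
    using martingale_mult(2)[OF N st h h1] by simp
  also have "\<dots> \<le> (\<integral> \<omega>. of_bool (B \<omega>) * \<bar>N t \<omega>\<bar> \<partial>P)"
  proof (rule integral_mono)
    show "integrable P (\<lambda>\<omega>. ?h \<omega> * N t \<omega>)" by (rule martingale_mult(1)[OF N st h h1])
    show "integrable P (\<lambda>\<omega>. of_bool (B \<omega>) * \<bar>N t \<omega>\<bar>)"
      by (rule Bochner_Integration.integrable_bound[of P "N t"]) (use int in auto)
    show "?h \<omega> * N t \<omega> \<le> of_bool (B \<omega>) * \<bar>N t \<omega>\<bar>" for \<omega>
      by (auto simp: sgn_if abs_if)
  qed
  finally show ?thesis .
qed

text \<open>The sums have expectation zero, so the limiting bound on \<open>\<xi>\<close> should
  give expectation at most zero. They need not be bounded below, but adding the overshoot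
  \<open>Q b K\<close> and the constant \<open>2 * n + b\<close> makes them nonnegative. Fatou's
  lemma then leaves only the mean overshoot, bounded by \<open>\<delta> b\<close> for every grid,
  and \<open>b\<close> tends to infinity. Since only a lower limit is taken, \<open>K0\<close> may
  depend on the path in any way.\<close>

lemma martingale_sum_fatou:
  fixes N w :: "real \<Rightarrow> 'a \<Rightarrow> real" and T n :: real
  assumes N: "martingale P F N" and contN: "\<And>\<omega>. \<omega> \<in> space P \<Longrightarrow> continuous_on {0..T} (\<lambda>t. N t \<omega>)"
    and T: "0 \<le> T" and n: "0 \<le> n"
    and G: "\<And>t. 0 \<le> t \<Longrightarrow> t \<le> T \<Longrightarrow> Measurable.pred (F t) (G t)"
    and G_decr: "\<And>s t \<omega>. s \<le> t \<Longrightarrow> G t \<omega> \<Longrightarrow> G s \<omega>"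
    and w: "\<And>t. 0 \<le> t \<Longrightarrow> t \<le> T \<Longrightarrow> w t \<in> borel_measurable (F t)"
      "\<And>t \<omega>. 0 \<le> w t \<omega>" "\<And>t \<omega>. w t \<omega> \<le> 1"
    and w_decr: "AE \<omega> in P. \<forall>s t. 0 \<le> s \<longrightarrow> s \<le> t \<longrightarrow> t \<le> T \<longrightarrow> w t \<omega> \<le> w s \<omega>"
    and bound: "AE \<omega> in P. \<forall>t\<in>{0..T}. G t \<omega> \<longrightarrow> \<bar>N t \<omega>\<bar> \<le> n"
    and \<xi>: "integrable P \<xi>"
      "AE \<omega> in P. \<forall>e>0. \<exists>K0. \<forall>K\<ge>K0. \<xi> \<omega> \<le> e + (\<Sum>j<K. w (T * real j / real K) \<omega> *
          of_bool (G (T * real j / real K) \<omega>) * (N (T * real (Suc j) / real K) \<omega> - N (T * real j / real K) \<omega>))"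
  shows "(\<integral> \<omega>. \<xi> \<omega> \<partial>P) \<le> 0"
proof -
  \<comment> \<open>With \<open>Suc K\<close> cells there is always at least one, so the denominator
    is never zero.\<close>
  define x where "x K j = T * real j / real (Suc K)" for K j :: nat
  define S where "S K \<omega> = (\<Sum>j<Suc K. w (x K j) \<omega> * of_bool (G (x K j) \<omega>) * (N (x K (Suc j)) \<omega> - N (x K j) \<omega>))" for K \<omega>
  define B where "B b K j \<omega> \<longleftrightarrow> G (x K j) \<omega> \<and> \<not> G (x K (Suc j)) \<omega> \<and> b < \<bar>N (x K (Suc j)) \<omega>\<bar>" for b :: real and K j \<omega>
  define Q where "Q b K \<omega> = (\<Sum>j<Suc K. of_bool (B b K j \<omega>) * \<bar>N (x K (Suc j)) \<omega>\<bar>)" for b K \<omega>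
  \<comment> \<open>By continuity, the event that \<open>\<bar>N\<bar>\<close> exceeds
    \<open>b\<close> somewhere on \<open>{0..T}\<close>. It contains the exit events
    \<open>B b K j\<close> of all grids at once, which is why \<open>\<delta>\<close> does not
    depend on \<open>K\<close>.\<close>
  define C where "C b \<omega> \<longleftrightarrow> (\<exists>q\<in>{0..T} \<inter> \<rat>. b < \<bar>N q \<omega>\<bar>)" for b :: real and \<omega>
  define \<delta> where "\<delta> b = (\<integral> \<omega>. of_bool (C b \<omega>) * \<bar>N T \<omega>\<bar> \<partial>P)" for b
  have x0: "0 \<le> x K j" for K j using T by (simp add: x_def)
  have xT: "x K j \<le> T" if "j \<le> Suc K" for K j
  proof -
    have "T * real j \<le> T * real (Suc K)" using that T by (intro mult_left_mono) auto
    then show ?thesis by (simp add: x_def divide_le_eq)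
  qed
  have xmono: "x K j \<le> x K (Suc j)" for K j
    unfolding x_def using T by (intro divide_right_mono mult_left_mono) auto
  have intN: "integrable P (N t)" and mN: "N t \<in> borel_measurable (F t)" if "0 \<le> t" for t
    using N that by (auto simp: martingale_def adapted_def)
  have mNP[measurable]: "N t \<in> borel_measurable P" if "0 \<le> t" for t
    using intN[OF that] by (rule borel_measurable_integrable)
  have [simp]: "countable ({0..T} \<inter> \<rat>)" using countable_rat by (rule countable_subset[rotated]) auto
  have mC[measurable]: "Measurable.pred P (C b)" for b
  proof -
    have "Measurable.pred P (\<lambda>\<omega>. \<not> (\<forall>q\<in>{0..T} \<inter> \<rat>. \<bar>N q \<omega>\<bar> \<le> b))"
    proof (intro pred_intros_logic measurable_pred_countable)
      fix q assume "q \<in> {0..T} \<inter> \<rat>"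
      then have [measurable]: "N q \<in> borel_measurable P" by (intro mNP) auto
      show "Measurable.pred P (\<lambda>\<omega>. \<bar>N q \<omega>\<bar> \<le> b)" by measurable
    qed simp
    then show ?thesis unfolding C_def[abs_def] by (simp add: not_le)
  qed
  have mB: "Measurable.pred (F (x K (Suc j))) (B b K j)" if "j \<le> K" for b K j
  proof -
    have [measurable]: "Measurable.pred (F (x K (Suc j))) (G (x K (Suc j)))"
      by (intro G x0 xT) (use that in simp)
    have [measurable]: "Measurable.pred (F (x K (Suc j))) (G (x K j))"
      by (rule measurable_F_mono[OF G xmono]) (use that x0 xT[of j K] in auto)
    have [measurable]: "N (x K (Suc j)) \<in> borel_measurable (F (x K (Suc j)))" by (intro mN x0)
    show ?thesis unfolding B_def[abs_def] by measurable
  qed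
  have mBP: "Measurable.pred P (B b K j)" if "j \<le> K" for b K j
    using mB[OF that] by (rule measurable_F_P)
  have int_of_bool: "integrable P (\<lambda>\<omega>. of_bool (A \<omega>) * \<bar>N t \<omega>\<bar>)" if "Measurable.pred P A" "0 \<le> t" for A t
  proof (rule Bochner_Integration.integrable_bound[OF intN[OF that(2)]])
    show "(\<lambda>\<omega>. of_bool (A \<omega>) * \<bar>N t \<omega>\<bar>) \<in> borel_measurable P"
      using that(1) mNP[OF that(2)] by measurable
  qed auto
  have S: "integrable P (S K)" "(\<integral> \<omega>. S K \<omega> \<partial>P) = 0" for K
  proof -
    let ?h = "\<lambda>j \<omega>. w (x K j) \<omega> * of_bool (G (x K j) \<omega>)"
    have h: "?h j \<in> borel_measurable (F (x K j))" "\<And>\<omega>. \<bar>?h j \<omega>\<bar> \<le> 1" if "j < Suc K" for j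
    proof -
      have [measurable]: "Measurable.pred (F (x K j)) (G (x K j))" "w (x K j) \<in> borel_measurable (F (x K j))"
        using that by (auto intro!: G w x0 xT)
      show "?h j \<in> borel_measurable (F (x K j))" by measurable
      show "\<bar>?h j \<omega>\<bar> \<le> 1" for \<omega> using w(2,3)[of "x K j" \<omega>] by auto
    qed
    note m1 = martingale_mult[OF N x0 xmono h] and m2 = martingale_mult[OF N x0 order_refl h]
    have eq: "S K \<omega> = (\<Sum>j<Suc K. ?h j \<omega> * N (x K (Suc j)) \<omega> - ?h j \<omega> * N (x K j) \<omega>)" for \<omega>
      unfolding S_def by (simp only: right_diff_distrib)
    show "integrable P (S K)"
      unfolding eq[abs_def] using m1(1) m2(1)
      by (intro Bochner_Integration.integrable_sum Bochner_Integration.integrable_diff) auto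
    have "(\<integral> \<omega>. S K \<omega> \<partial>P) = (\<Sum>j<Suc K. (\<integral> \<omega>. ?h j \<omega> * N (x K (Suc j)) \<omega> - ?h j \<omega> * N (x K j) \<omega> \<partial>P))"
      unfolding eq using m1(1) m2(1)
      by (intro Bochner_Integration.integral_sum Bochner_Integration.integrable_diff) auto
    also have "\<dots> = 0"
    proof (intro sum.neutral ballI)
      fix j assume j: "j \<in> {..<Suc K}"
      then show "(\<integral> \<omega>. ?h j \<omega> * N (x K (Suc j)) \<omega> - ?h j \<omega> * N (x K j) \<omega> \<partial>P) = 0"
        using m1[of j] m2(1)[of j] by (subst Bochner_Integration.integral_diff) auto
    qed
    finally show "(\<integral> \<omega>. S K \<omega> \<partial>P) = 0" .
  qed
  have Q: "integrable P (Q b K)" "(\<integral> \<omega>. Q b K \<omega> \<partial>P) \<le> \<delta> b" for b K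
  proof -
    have I: "integrable P (\<lambda>\<omega>. of_bool (B b K j \<omega>) * \<bar>N t \<omega>\<bar>)" if "j < Suc K" "0 \<le> t" for j t
      using that by (intro int_of_bool mBP) auto
    show "integrable P (Q b K)"
      unfolding Q_def[abs_def] by (intro Bochner_Integration.integrable_sum I x0) auto
    have "(\<integral> \<omega>. Q b K \<omega> \<partial>P) = (\<Sum>j<Suc K. (\<integral> \<omega>. of_bool (B b K j \<omega>) * \<bar>N (x K (Suc j)) \<omega>\<bar> \<partial>P))"
      unfolding Q_def by (intro Bochner_Integration.integral_sum I x0) auto
    \<comment> \<open>Each exit event is known at the right end of its cell, so its overshoot can be
      pushed forward to \<open>T\<close>. Then \<open>\<bar>N T\<bar>\<close> is a common factor,
      and since at most one exit occurs, the indicators add up to at most that of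
      \<open>C b\<close>.\<close>
    also have "\<dots> \<le> (\<Sum>j<Suc K. (\<integral> \<omega>. of_bool (B b K j \<omega>) * \<bar>N T \<omega>\<bar> \<partial>P))"
      by (intro sum_mono martingale_abs_mono[OF N x0 xT] mB) auto
    also have "\<dots> = (\<integral> \<omega>. (\<Sum>j<Suc K. of_bool (B b K j \<omega>) * \<bar>N T \<omega>\<bar>) \<partial>P)"
      by (rule Bochner_Integration.integral_sum[symmetric]) (use T in \<open>auto intro!: I\<close>)
    also have "\<dots> \<le> \<delta> b"
      unfolding \<delta>_def
    proof (rule integral_mono)
      show "integrable P (\<lambda>\<omega>. \<Sum>j<Suc K. of_bool (B b K j \<omega>) * \<bar>N T \<omega>\<bar>)"
        using T by (intro Bochner_Integration.integrable_sum I) auto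
      show "integrable P (\<lambda>\<omega>. of_bool (C b \<omega>) * \<bar>N T \<omega>\<bar>)"
        using T by (intro int_of_bool mC)
      fix \<omega> assume \<omega>: "\<omega> \<in> space P"
      have "(\<Sum>j<Suc K. of_bool (B b K j \<omega>) :: real) \<le> of_bool (C b \<omega>)"
      proof (cases "C b \<omega>")
        case True
        have "(\<Sum>j<Suc K. of_bool (B b K j \<omega>) :: real) \<le> (\<Sum>j<Suc K. of_bool (G (x K j) \<omega> \<and> \<not> G (x K (Suc j)) \<omega>))"
          by (intro sum_mono) (auto simp: B_def)
        also have "\<dots> \<le> 1"
          by (rule sum_of_bool_exit_le_one) (use G_decr[OF xmono] in blast)
        finally show ?thesis using True by simp
      next
        case False
        have "\<not> B b K j \<omega>" if "j < Suc K" for j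
        proof -
          have "\<bar>N (x K (Suc j)) \<omega>\<bar> \<le> b"
          proof (rule le_of_rational_le[where f = "\<lambda>t. \<bar>N t \<omega>\<bar>" and t = T])
            show "continuous_on {0..T} (\<lambda>t. \<bar>N t \<omega>\<bar>)" by (intro continuous_intros contN \<omega>)
            show "x K (Suc j) \<in> {0..T}" using x0[of K "Suc j"] xT[of "Suc j" K] that by auto
          qed (use False in \<open>auto simp: C_def not_less\<close>)
          then show ?thesis by (simp add: B_def)
        qed
        then show ?thesis by simp
      qed
      then show "(\<Sum>j<Suc K. of_bool (B b K j \<omega>) * \<bar>N T \<omega>\<bar>) \<le> of_bool (C b \<omega>) * \<bar>N T \<omega>\<bar>"
        unfolding sum_distrib_right[symmetric] by (intro mult_right_mono) auto
    qed
    finally show "(\<integral> \<omega>. Q b K \<omega> \<partial>P) \<le> \<delta> b" .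
  qed
  \<comment> \<open>The shift by \<open>?c\<close> is there only to make Fatou's lemma applicable;
    it appears on both sides and cancels, whatever \<open>b\<close> is.\<close>
  have bound_\<delta>: "(\<integral> \<omega>. \<xi> \<omega> \<partial>P) \<le> \<delta> b" if b: "0 \<le> b" for b
  proof -
    let ?c = "2 * n + b"
    have [measurable]: "\<xi> \<in> borel_measurable P" "S K \<in> borel_measurable P" "Q b K \<in> borel_measurable P" for K
      using \<xi>(1) S(1) Q(1) by auto
    have nonneg: "AE \<omega> in P. 0 \<le> S K \<omega> + Q b K \<omega> + ?c" for K
      using w_decr bound
    proof eventually_elim
      case (elim \<omega>)
      have "- ?c - Q b K \<omega> \<le> S K \<omega>"
        unfolding S_def Q_def B_def
      proof (rule stopped_sum_lower_bound)
        fix j assume "j < Suc K"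
        then show "w (x K (Suc j)) \<omega> \<le> w (x K j) \<omega>"
          using elim(1) x0 xmono[of K j] xT[of "Suc j" K] by auto
        show "G (x K (Suc j)) \<omega> \<Longrightarrow> G (x K j) \<omega>" using G_decr[OF xmono] by blast
      next
        fix j assume "j \<le> Suc K" "G (x K j) \<omega>"
        then show "\<bar>N (x K j) \<omega>\<bar> \<le> n" using elim(2) x0[of K j] xT[of j K] by auto
      qed (use w n b in auto)
      then show ?case by simp
    qed
    have "(\<integral>\<^sup>+ \<omega>. ennreal (\<xi> \<omega> + ?c) \<partial>P) \<le> (\<integral>\<^sup>+ \<omega>. liminf (\<lambda>K. ennreal (S K \<omega> + Q b K \<omega> + ?c)) \<partial>P)"
    proof (rule nn_integral_mono_AE)
      show "AE \<omega> in P. ennreal (\<xi> \<omega> + ?c) \<le> liminf (\<lambda>K. ennreal (S K \<omega> + Q b K \<omega> + ?c))"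
        using \<xi>(2)
      proof eventually_elim
        case (elim \<omega>)
        show ?case
        proof (rule ennreal_le_epsilon)
          fix e :: real assume e: "0 < e"
          then obtain K0 where K0: "\<And>K. K \<ge> K0 \<Longrightarrow> \<xi> \<omega> \<le> e + (\<Sum>j<K. w (T * real j / real K) \<omega> *
            of_bool (G (T * real j / real K) \<omega>) * (N (T * real (Suc j) / real K) \<omega> - N (T * real j / real K) \<omega>))"
            using elim by blast
          have "ennreal (\<xi> \<omega> + ?c - e) \<le> liminf (\<lambda>K. ennreal (S K \<omega> + Q b K \<omega> + ?c))"
          proof (rule Liminf_bounded, rule eventually_sequentiallyI)
            fix K assume "K0 \<le> K"
            then have "\<xi> \<omega> \<le> e + S K \<omega>" using K0[of "Suc K"] by (simp add: S_def x_def del: of_nat_Suc sum.lessThan_Suc)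
            moreover have "0 \<le> Q b K \<omega>" unfolding Q_def by (intro sum_nonneg) auto
            ultimately show "ennreal (\<xi> \<omega> + ?c - e) \<le> ennreal (S K \<omega> + Q b K \<omega> + ?c)"
              by (intro ennreal_leI) simp
          qed
          then have "ennreal (\<xi> \<omega> + ?c - e) + ennreal e \<le> liminf (\<lambda>K. ennreal (S K \<omega> + Q b K \<omega> + ?c)) + ennreal e"
            by (rule add_right_mono)
          moreover have "ennreal (\<xi> \<omega> + ?c) \<le> ennreal (\<xi> \<omega> + ?c - e) + ennreal e"
          proof -
            \<comment> \<open>The \<open>max 0\<close> mirrors the truncation of negative reals by
              \<open>ennreal\<close>.\<close>
            have "ennreal (\<xi> \<omega> + ?c) \<le> ennreal (max 0 (\<xi> \<omega> + ?c - e) + e)" by (rule ennreal_leI) simp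
            also have "\<dots> = ennreal (\<xi> \<omega> + ?c - e) + ennreal e" using e by (cases "0 \<le> \<xi> \<omega> + ?c - e") (auto simp: max_def ennreal_neg simp flip: ennreal_plus)
            finally show ?thesis .
          qed
          ultimately show "ennreal (\<xi> \<omega> + ?c) \<le> liminf (\<lambda>K. ennreal (S K \<omega> + Q b K \<omega> + ?c)) + ennreal e"
            by (rule order_trans[rotated])
        qed
      qed
    qed
    also have "\<dots> \<le> liminf (\<lambda>K. \<integral>\<^sup>+ \<omega>. ennreal (S K \<omega> + Q b K \<omega> + ?c) \<partial>P)"
      by (rule nn_integral_liminf) measurable
    also have "\<dots> \<le> ennreal (\<delta> b + ?c)"
    proof (rule Liminf_le)
      show "\<forall>\<^sub>F K in sequentially. (\<integral>\<^sup>+ \<omega>. ennreal (S K \<omega> + Q b K \<omega> + ?c) \<partial>P) \<le> ennreal (\<delta> b + ?c)"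
      proof (rule always_eventually, rule allI)
        fix K
        have "(\<integral>\<^sup>+ \<omega>. ennreal (S K \<omega> + Q b K \<omega> + ?c) \<partial>P) = ennreal (\<integral> \<omega>. S K \<omega> + Q b K \<omega> + ?c \<partial>P)"
          using nonneg by (intro nn_integral_eq_integral) (auto intro!: S Q)
        also have "(\<integral> \<omega>. S K \<omega> + Q b K \<omega> + ?c \<partial>P) = (\<integral> \<omega>. Q b K \<omega> \<partial>P) + ?c"
          using S Q by (simp add: prob_space)
        also have "ennreal \<dots> \<le> ennreal (\<delta> b + ?c)" using Q by (intro ennreal_leI) simp
        finally show "(\<integral>\<^sup>+ \<omega>. ennreal (S K \<omega> + Q b K \<omega> + ?c) \<partial>P) \<le> ennreal (\<delta> b + ?c)" .
      qed
    qed simp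
    finally have "(\<integral> \<omega>. \<xi> \<omega> + ?c \<partial>P) \<le> \<delta> b + ?c"
    proof (rule integral_le_if_nn_integral_le[rotated])
      have "0 \<le> \<delta> b" unfolding \<delta>_def by (intro integral_nonneg_AE) auto
      then show "0 \<le> \<delta> b + ?c" using n b by simp
    qed (use \<xi> in auto)
    then show ?thesis using \<xi> by (simp add: prob_space)
  qed
  \<comment> \<open>Each path is bounded on \<open>{0..T}\<close>, so \<open>C b\<close> fails for
    large \<open>b\<close>; the integrable function \<open>\<bar>N T\<bar>\<close>
    dominates.\<close>
  have "(\<lambda>b::nat. \<delta> (real b)) \<longlonglongrightarrow> (\<integral> \<omega>. 0 \<partial>P)"
    unfolding \<delta>_def
  proof (rule integral_dominated_convergence[where w = "\<lambda>\<omega>. \<bar>N T \<omega>\<bar>"])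
    show "AE \<omega> in P. (\<lambda>b. of_bool (C (real b) \<omega>) * \<bar>N T \<omega>\<bar>) \<longlonglongrightarrow> 0"
    proof (rule AE_I2)
      fix \<omega> assume \<omega>: "\<omega> \<in> space P"
      have "bounded ((\<lambda>t. N t \<omega>) ` {0..T})"
        by (intro compact_imp_bounded compact_continuous_image contN \<omega>) auto
      then obtain k where k: "\<forall>t\<in>{0..T}. \<bar>N t \<omega>\<bar> \<le> k"
        unfolding bounded_iff real_norm_def by blast
      have "\<not> C (real b) \<omega>" if "b \<ge> nat \<lceil>k\<rceil>" for b
      proof -
        have "k \<le> real b" using that by linarith
        then show ?thesis using k unfolding C_def by force
      qed
      then have "\<forall>\<^sub>F b in sequentially. of_bool (C (real b) \<omega>) * \<bar>N T \<omega>\<bar> = 0"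
        unfolding eventually_sequentially by (intro exI[of _ "nat \<lceil>k\<rceil>"]) simp
      then show "(\<lambda>b. of_bool (C (real b) \<omega>) * \<bar>N T \<omega>\<bar>) \<longlonglongrightarrow> 0"
        by (rule tendsto_eventually)
    qed
  qed (use T intN in \<open>auto intro!: borel_measurable_times\<close>)
  then have "(\<lambda>b::nat. \<delta> (real b)) \<longlonglongrightarrow> 0" by simp
  then show ?thesis
    by (rule LIMSEQ_le_const) (use bound_\<delta> in auto)
qed

end

section \<open>The stopped pathwise bound\<close>

text \<open>In the application, \<open>\<theta>\<close> is a localising time capped at
  \<open>T\<close>, and \<open>E\<close> says that neither it nor the level \<open>n\<close>
  interferes up to \<open>T\<close>. The Gronwall estimate is evaluated at \<open>r\<close>, the
  grid time where \<open>G\<close> is first seen to fail, capped by \<open>\<theta>\<close>. There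
  it gives \<open>x r \<le> min a c + 2 * e / 3 + S\<close>. If \<open>a < c\<close> and
  \<open>E\<close> hold, \<open>G\<close> can fail only because \<open>x\<close> has reached
  \<open>c\<close>, and this happened within the last cell, so \<open>x r\<close> is at least
  \<open>c - e/3\<close>; if \<open>G\<close> never fails, \<open>x r\<close> is \<open>x T\<close>.
  In all other cases the left-hand side is \<open>- min a c\<close>, and \<open>0 \<le> x r\<close>
  is enough.\<close>

lemma pathwise_stopped_bound:
  fixes f z h m :: "real \<Rightarrow> real" and c n \<theta> T :: real
  defines "w \<equiv> \<lambda>t. exp (- enn2real (time_integral f t))"
  defines "x \<equiv> \<lambda>t. w t * z t"
  defines "G \<equiv> \<lambda>t. \<forall>s\<in>{0..t}. \<bar>m s\<bar> < n \<and> h s < c \<and> x s < c"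
  defines "a \<equiv> SUP s\<in>{0..T}. h s"
  assumes T: "0 \<le> T" and f: "f \<in> borel_measurable (restrict_space borel {0..T})"
      "\<And>s. 0 \<le> s \<Longrightarrow> s \<le> T \<Longrightarrow> 0 \<le> f s" "time_integral f T < \<infinity>"
    and z: "continuous_on {0..T} z" "\<And>s. 0 \<le> s \<Longrightarrow> s \<le> T \<Longrightarrow> 0 \<le> z s"
    and h: "continuous_on {0..T} h" "\<And>s. 0 \<le> s \<Longrightarrow> s \<le> T \<Longrightarrow> 0 \<le> h s"
    and m: "continuous_on {0..T} m" "m 0 = 0"
    and ineq: "\<And>t. 0 \<le> t \<Longrightarrow> t \<le> T \<Longrightarrow> z t \<le> enn2real (time_integral (\<lambda>s. f s * z s) t) + m t + h t"
    and c: "0 < c" and \<theta>: "0 \<le> \<theta>" "\<theta> \<le> T"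
    and E: "E \<Longrightarrow> \<theta> = T \<and> (\<forall>s\<in>{0..T}. \<bar>m s\<bar> < n)"
    and e: "0 < e"
  shows "\<exists>K0. \<forall>K\<ge>K0. (if \<forall>s\<in>{0..T}. x s < c then min (x T) c else c) * of_bool (a < c) * of_bool E - min a c
      \<le> e + (\<Sum>j<K. w (T * real j / real K) * of_bool (G (T * real j / real K)) *
           (m (min (T * real (Suc j) / real K) \<theta>) - m (min (T * real j / real K) \<theta>)))"
proof -
  define \<Psi> where "\<Psi> = (\<lambda>t. enn2real (time_integral f t))"
  define U where "U = (\<lambda>t. enn2real (time_integral (\<lambda>s. f s * z s) t))"
  have P: "continuous_on {0..T} \<Psi>" "continuous_on {0..T} U" "\<Psi> 0 = 0" "U 0 = 0"
    unfolding \<Psi>_def U_def by (rule path_integrals; fact T f z)+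
  have P5: "\<Psi> s \<le> \<Psi> t" if "0 \<le> s" "s \<le> t" "t \<le> T" for s t
    unfolding \<Psi>_def by (rule path_integrals(5)[where T = T and z = z]) (fact T f z that)+
  have P6: "U t - U s \<le> C * (\<Psi> t - \<Psi> s)" if "0 \<le> s" "s \<le> t" "t \<le> T" "\<And>x. s \<le> x \<Longrightarrow> x \<le> t \<Longrightarrow> z x \<le> C" for s t C
    unfolding \<Psi>_def U_def by (rule path_integrals(6)[where T = T]) (fact T f z that)+
  have w: "w = (\<lambda>t. exp (- \<Psi> t))" by (simp add: w_def \<Psi>_def)
  have e3: "0 < e/3" using e by simp
  have "\<exists>K0>0. \<forall>K\<ge>K0. \<forall>r\<in>{0..T}. \<forall>B. (\<forall>s\<in>{0..r}. z s \<le> U s + m s + B) \<longrightarrow>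
     exp (- \<Psi> r) * z r \<le> B + e/3 + (\<Sum>j<K. exp (- \<Psi> (min (T * real j / real K) r)) *
        (m (min (T * real (Suc j) / real K) r) - m (min (T * real j / real K) r)))"
    by (rule pathwise_gronwall) (fact T m P z P5 P6 e3)+
  then obtain K0 where K0: "K0 > 0" "\<And>K r B. K \<ge> K0 \<Longrightarrow> r \<in> {0..T} \<Longrightarrow> (\<forall>s\<in>{0..r}. z s \<le> U s + m s + B)
     \<Longrightarrow> x r \<le> B + e/3 + (\<Sum>j<K. w (min (T * real j / real K) r) *
        (m (min (T * real (Suc j) / real K) r) - m (min (T * real j / real K) r)))"
    unfolding w x_def by blast
  have contx: "continuous_on {0..T} x"
    unfolding x_def w by (intro continuous_intros P z)
  have "uniformly_continuous_on {0..T} x" "uniformly_continuous_on {0..T} h"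
    by (intro compact_uniformly_continuous contx h compact_Icc)+
  then obtain d1 d2 where d1: "d1 > 0"
      "\<And>s t. s \<in> {0..T} \<Longrightarrow> t \<in> {0..T} \<Longrightarrow> dist t s < d1 \<Longrightarrow> dist (x t) (x s) < e/3"
    and d2: "d2 > 0"
      "\<And>s t. s \<in> {0..T} \<Longrightarrow> t \<in> {0..T} \<Longrightarrow> dist t s < d2 \<Longrightarrow> dist (h t) (h s) < e/3"
    unfolding uniformly_continuous_on_def using e3 by metis
  define d where "d = min d1 d2"
  have d: "d > 0" using d1 d2 by (simp add: d_def)
  obtain K1 :: nat where K1: "T / d < real K1" using reals_Archimedean2 by blast
  have x_nonneg: "0 \<le> x s" if "0 \<le> s" "s \<le> T" for s using z(2)[OF that] by (simp add: x_def w)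
  have "bdd_above (h ` {0..T})"
    using h(1) by (intro bounded_imp_bdd_above compact_imp_bounded compact_continuous_image) auto
  then have h_le: "h s \<le> a" if "0 \<le> s" "s \<le> T" for s
    unfolding a_def using that by (intro cSUP_upper) auto
  have a_nonneg: "0 \<le> a" using h(2)[of 0] h_le[of 0] T by linarith
  have G_decr: "G s" if "s \<le> t" "G t" for s t using that by (auto simp: G_def)
  let ?\<xi> = "(if \<forall>s\<in>{0..T}. x s < c then min (x T) c else c) * of_bool (a < c) * of_bool E - min a c"
  show ?thesis
  proof (intro exI[of _ "max K0 K1"] allI impI)
    fix K assume K: "max K0 K1 \<le> K"
    have Kpos: "0 < K" using K K0(1) by simp
    define t where "t j = T * real j / real K" for j
    define S where "S = (\<Sum>j<K. w (t j) * of_bool (G (t j)) * (m (min (t (Suc j)) \<theta>) - m (min (t j) \<theta>)))"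
    have t0: "t 0 = 0" and tK: "t K = T" using Kpos by (simp_all add: t_def)
    have t_mono: "t i \<le> t j" if "i \<le> j" for i j
      unfolding t_def using T that by (intro divide_right_mono mult_left_mono) auto
    have t_nonneg: "0 \<le> t j" for j using t_mono[of 0 j] t0 by simp
    have t_le: "t j \<le> T" if "j \<le> K" for j using t_mono[OF that] tK by simp
    have t_mesh: "t (Suc j) - t j < d" for j
    proof -
      have "t (Suc j) - t j = T / real K" unfolding t_def by (simp add: add_divide_distrib distrib_left)
      also have "\<dots> < d"
      proof -
        have "T < real K1 * d" using K1 d by (simp add: divide_less_eq)
        also have "\<dots> \<le> real K * d" using K d by (intro mult_right_mono) auto
        finally show ?thesis using Kpos by (simp add: divide_less_eq mult.commute)
      qed
      finally show ?thesis .
    qed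
    define J where "J = (LEAST j. j = K \<or> \<not> G (t j))"
    have J: "J = K \<or> \<not> G (t J)" unfolding J_def by (rule LeastI[of _ K]) simp
    have J_le: "J \<le> K" unfolding J_def by (rule Least_le) simp
    have J_less: "G (t j)" if "j < J" for j using not_less_Least[of j] that unfolding J_def by blast
    define r where "r = min (t J) \<theta>"
    have r: "0 \<le> r" "r \<le> T" "r \<le> t J" using \<theta> t_nonneg t_le[OF J_le] by (auto simp: r_def)
    \<comment> \<open>Stopping the grid at \<open>r\<close> and switching off the coefficients once
      \<open>G\<close> has failed give the same sum. Past \<open>t J\<close> the increments on the
      left vanish, as do the coefficients on the right; past \<open>\<theta>\<close> the increments
      on both sides vanish, so the different arguments of \<open>w\<close> do not matter.\<close>
    have sum_eq: "(\<Sum>j<K. w (min (t j) r) * (m (min (t (Suc j)) r) - m (min (t j) r))) = S"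
      unfolding S_def
    proof (intro sum.cong refl)
      fix j assume j: "j \<in> {..<K}"
      show "w (min (t j) r) * (m (min (t (Suc j)) r) - m (min (t j) r))
         = w (t j) * of_bool (G (t j)) * (m (min (t (Suc j)) \<theta>) - m (min (t j) \<theta>))"
      proof (cases "j < J")
        case True
        have 1: "t j \<le> t J" "t (Suc j) \<le> t J" "t j \<le> t (Suc j)" using True by (auto intro!: t_mono)
        have eq: "min (t (Suc j)) r = min (t (Suc j)) \<theta>" "min (t j) r = min (t j) \<theta>"
          using 1 by (auto simp: r_def)
        show ?thesis
        proof (cases "t j \<le> \<theta>")
          case True
          then show ?thesis unfolding eq using J_less[OF \<open>j < J\<close>] by simp
        next
          case False
          then have "min (t (Suc j)) \<theta> = \<theta>" "min (t j) \<theta> = \<theta>" using 1 by auto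
          then show ?thesis unfolding eq by simp
        qed
      next
        case False
        then have JK: "J < K" using j by simp
        then have "\<not> G (t J)" using J by simp
        then have "\<not> G (t j)" using G_decr[OF t_mono[of J j]] False by auto
        moreover have "min (t (Suc j)) r = r" "min (t j) r = r"
          using r t_mono[of J j] t_mono[of J "Suc j"] False by auto
        ultimately show ?thesis by simp
      qed
    qed
    have x_le: "x r \<le> B + e/3 + S" if "\<And>s. 0 \<le> s \<Longrightarrow> s \<le> r \<Longrightarrow> h s \<le> B" for B
    proof -
      have "\<forall>s\<in>{0..r}. z s \<le> U s + m s + B"
        using that ineq r unfolding U_def by force
      moreover have "K0 \<le> K" "r \<in> {0..T}" using K r by auto
      ultimately show ?thesis using K0(2)[of K r B] unfolding t_def[symmetric] sum_eq by simp
    qed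
    have "?\<xi> \<le> e + S"
    \<comment> \<open>If \<open>G\<close> fails at time \<open>0\<close>, then \<open>S\<close>
      vanishes and the first term of \<open>?\<xi>\<close> has to vanish too. It does: at time
      \<open>0\<close> the integral and \<open>m\<close> are zero, so \<open>x 0 \<le> h 0\<close>,
      and with \<open>a < c\<close> and \<open>E\<close> this would give \<open>G 0\<close>.\<close>
    proof (cases "G 0")
      case False
      have "\<not> G (t j)" for j using False G_decr[of 0 "t j"] t_nonneg by blast
      then have "S = 0" by (simp add: S_def)
      moreover have "\<not> (a < c \<and> E)"
      proof
        assume *: "a < c \<and> E"
        have "x 0 \<le> z 0" using P(3) by (simp add: x_def w)
        also have "z 0 \<le> h 0" using ineq[of 0] P(4) m T by (simp add: U_def)
        also have h0: "h 0 < c" using h_le[of 0] * T by simp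
        finally have "G 0" using h0 E * T by (auto simp: G_def)
        with False show False ..
      qed
      ultimately show ?thesis using e a_nonneg c by auto
    next
      case True
      have "J \<noteq> 0"
      proof
        assume "J = 0"
        then show False using J True t0 Kpos by simp
      qed
      then obtain i where i: "J = Suc i" using not0_implies_Suc by blast
      have Gi: "G (t i)" using J_less i by simp
      have close: "dist s (t i) < d" if "t i \<le> s" "s \<le> t J" for s
        using that t_mesh[of i] i by (simp add: dist_real_def)
      have ti: "t i \<in> {0..T}" using t_nonneg t_le[of i] J_le i by auto
      \<comment> \<open>The bound \<open>h < c\<close> is known up to \<open>t i\<close>, one cell
        before the crossing is noticed; uniform continuity covers the remaining cell at the price of
        \<open>e/3\<close>.\<close>
      have "h s \<le> min a c + e/3" if s: "0 \<le> s" "s \<le> r" for s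
      proof -
        have "h s < c + e/3"
        proof (cases "s \<le> t i")
          case True
          then have "h s < c" using Gi s by (auto simp: G_def)
          then show ?thesis using e by simp
        next
          case False
          have "dist (h s) (h (t i)) < e/3"
            using close[of s] False s r ti by (intro d2) (auto simp: d_def)
          moreover have "h (t i) < c" using Gi ti by (auto simp: G_def)
          ultimately show ?thesis unfolding dist_real_def by linarith
        qed
        moreover have "h s \<le> a" using h_le s r by simp
        ultimately show ?thesis using e by (auto simp: min_def)
      qed
      from x_le[OF this] have xr: "x r \<le> min a c + e/3 + e/3 + S" by simp
      show ?thesis
      proof (cases "a < c \<and> E")
        case False
        then have "?\<xi> = - min a c" by auto
        then show ?thesis using xr x_nonneg[of r] r e by linarith
      next
        case aE: True
        then have \<theta>T: "\<theta> = T" and mn: "\<And>s. s \<in> {0..T} \<Longrightarrow> \<bar>m s\<bar> < n" using E by auto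
        have rt: "r = t J" using \<theta>T t_le[OF J_le] by (simp add: r_def)
        have G_iff: "G s \<longleftrightarrow> (\<forall>u\<in>{0..s}. x u < c)" if "s \<le> T" for s
          unfolding G_def using mn aE h_le that by fastforce
        show ?thesis
        proof (cases "\<forall>s\<in>{0..T}. x s < c")
          case True
          then have "G T" using G_iff by simp
          then have "J = K" using J G_decr[OF t_le[OF J_le]] by blast
          then have "r = T" using rt tK by simp
          then show ?thesis using xr aE True e T by auto
        next
          case False
          then have "\<not> G T" using G_iff by simp
          \<comment> \<open>The case \<open>J = K\<close> is included because
            \<open>t K = T\<close>: a crossing in the very last cell is still noticed at
            \<open>T\<close>.\<close>
          then have "\<not> G (t J)" using J tK by auto
          then have "\<not> (\<forall>u\<in>{0..t J}. x u < c)" using G_iff[OF t_le[OF J_le]] by simp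
          then obtain u where u: "0 \<le> u" "u \<le> t J" "c \<le> x u"
            by (meson atLeastAtMost_iff not_less)
          have "t i < u"
            using Gi u by (force simp: G_def not_less[symmetric])
          then have "dist u (t J) < d1"
            using u close[of u] t_mesh[of i] i by (simp add: dist_real_def d_def)
          then have "dist (x u) (x (t J)) < e/3"
            using u t_le[OF J_le] t_nonneg by (intro d1) auto
          then have "c - e/3 \<le> x r" using u unfolding rt dist_real_def by linarith
          moreover have "?\<xi> = c - min a c" using aE False by auto
          ultimately show ?thesis using xr by linarith
        qed
      qed
    qed
    then show "?\<xi> \<le> e + (\<Sum>j<K. w (T * real j / real K) * of_bool (G (T * real j / real K)) *
           (m (min (T * real (Suc j) / real K) \<theta>) - m (min (T * real j / real K) \<theta>)))"
      by (simp add: S_def t_def)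
  qed
qed

text \<open>Capped at the horizon \<open>T\<close>, a possibly infinite stopping time becomes one
  real number that describes the stopping at all times up to \<open>T\<close>.\<close>

lemma stopped_eq:
  assumes "0 \<le> t" "t \<le> T"
  shows "stopped X \<tau> t \<omega> = X (min t (enn2real (min (ennreal T) (\<tau> \<omega>)))) \<omega>"
proof (cases "\<tau> \<omega>")
  case (real r)
  then show ?thesis using assms by (auto simp: stopped_def min_def)
next
  case top
  then show ?thesis using assms by (simp add: stopped_def min_def)
qed

section \<open>The truncated maximal inequality\<close>

lemma (in filtered_prob_space) running_sup_measurable:
  assumes H: "adapted F H" "continuous_paths P H" and T: "0 \<le> T"
  shows "running_sup H T \<in> borel_measurable P"
proof -
  have mH: "H q \<in> borel_measurable P" if "0 \<le> q" for q
    using H(1) that by (auto simp: adapted_def intro: measurable_F_P)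
  have cont: "continuous_on {0..T} (\<lambda>t. H t \<omega>)" if "\<omega> \<in> space P" for \<omega>
    using H(2) that by (auto simp: continuous_paths_def intro: continuous_on_subset)
  have bdd: "bdd_above ((\<lambda>t. H t \<omega>) ` {0..T})" if "\<omega> \<in> space P" for \<omega>
    using cont[OF that] by (intro bounded_imp_bdd_above compact_imp_bounded compact_continuous_image) auto
  have bddQ: "bdd_above ((\<lambda>t. H t \<omega>) ` ({0..T} \<inter> \<rat>))" if "\<omega> \<in> space P" for \<omega>
    using bdd[OF that] by (rule bdd_above_mono) auto
  have Q: "{0..T} \<inter> \<rat> \<noteq> {}" "countable ({0..T} \<inter> \<rat>)"
    using T countable_rat by (auto intro: countable_subset[rotated] exI[of _ 0])
  have "running_sup H T \<omega> = (SUP q\<in>{0..T} \<inter> \<rat>. H q \<omega>)" if \<omega>: "\<omega> \<in> space P" for \<omega>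
    unfolding running_sup_def
  proof (rule antisym)
    show "(SUP s\<in>{0..T}. H s \<omega>) \<le> (SUP q\<in>{0..T} \<inter> \<rat>. H q \<omega>)"
    proof (rule cSUP_least)
      fix s assume s: "s \<in> {0..T}"
      show "H s \<omega> \<le> (SUP q\<in>{0..T} \<inter> \<rat>. H q \<omega>)"
        by (rule le_of_rational_le[OF cont[OF \<omega>] _ s]) (rule cSUP_upper[OF _ bddQ[OF \<omega>]])
    qed (use T in auto)
    show "(SUP q\<in>{0..T} \<inter> \<rat>. H q \<omega>) \<le> (SUP s\<in>{0..T}. H s \<omega>)"
      by (rule cSUP_subset_mono) (use Q bdd[OF \<omega>] in auto)
  qed
  moreover have "(\<lambda>\<omega>. SUP q\<in>{0..T} \<inter> \<rat>. H q \<omega>) \<in> borel_measurable P"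
    by (rule borel_measurable_cSUP) (use Q bddQ mH in auto)
  ultimately show ?thesis by (simp cong: measurable_cong)
qed

section \<open>The discounted process and its truncated supremum\<close>

locale stochastic_gronwall = filtered_prob_space P F
  for P :: "'a measure" and F :: "real \<Rightarrow> 'a measure" +
  fixes Z H \<psi> M :: "real \<Rightarrow> 'a \<Rightarrow> real"
  assumes Z: "nonneg_process P Z" "adapted F Z" "continuous_paths P Z"
    and H: "nonneg_process P H" "adapted F H" "continuous_paths P H"
    and \<psi>: "nonneg_process P \<psi>" "progressively_measurable F \<psi>"
    and M: "continuous_local_martingale P F M" "AE \<omega> in P. M 0 \<omega> = 0"
    and gronwall: "AE \<omega> in P. \<forall>t\<ge>0. ereal (Z t \<omega>)
           \<le> enn2ereal (time_integral (\<lambda>s. \<psi> s \<omega> * Z s \<omega>) t) + ereal (M t \<omega>) + ereal (H t \<omega>)"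
begin

text \<open>Where the integral is infinite, \<open>enn2real\<close> returns \<open>0\<close> and the
  weight jumps back to \<open>1\<close>. It is still measurable and between \<open>0\<close> and
  \<open>1\<close> on every path; monotonicity in time is lost on such paths.\<close>

definition weight :: "real \<Rightarrow> 'a \<Rightarrow> real" where
  "weight t \<omega> = exp (- enn2real (time_integral (\<lambda>s. \<psi> s \<omega>) t))"

definition discounted :: "real \<Rightarrow> 'a \<Rightarrow> real" where
  "discounted t \<omega> = weight t \<omega> * Z t \<omega>"

lemma discounted_nonneg: "\<omega> \<in> space P \<Longrightarrow> 0 \<le> t \<Longrightarrow> 0 \<le> discounted t \<omega>"
  using Z(1) by (simp add: discounted_def weight_def nonneg_process_def)

lemma weight_measurable: "0 \<le> t \<Longrightarrow> weight t \<in> borel_measurable (F t)"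
  unfolding weight_def[abs_def] using time_integral_measurable(1)[OF \<psi>(2)] by measurable

lemma discounted_measurable: "0 \<le> t \<Longrightarrow> discounted t \<in> borel_measurable (F t)"
  unfolding discounted_def[abs_def] using weight_measurable Z(2) by (auto simp: adapted_def intro: borel_measurable_times)

lemma good_path:
  assumes \<omega>: "\<omega> \<in> space P" and T: "0 \<le> T" and fin: "time_integral (\<lambda>s. \<psi> s \<omega>) T < \<infinity>"
  shows "continuous_on {0..T} (\<lambda>t. discounted t \<omega>)"
    and "0 \<le> s \<Longrightarrow> s \<le> t \<Longrightarrow> t \<le> T \<Longrightarrow> weight t \<omega> \<le> weight s \<omega>"
    and "0 \<le> t \<Longrightarrow> t \<le> T \<Longrightarrow> time_integral (\<lambda>s. \<psi> s \<omega> * Z s \<omega>) t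
        = ennreal (enn2real (time_integral (\<lambda>s. \<psi> s \<omega> * Z s \<omega>) t))"
proof -
  have f: "(\<lambda>s. \<psi> s \<omega>) \<in> borel_measurable (restrict_space borel {0..T})"
    by (rule time_integral_measurable(2)[OF \<psi>(2) T \<omega>])
  have f0: "\<And>s. 0 \<le> s \<Longrightarrow> s \<le> T \<Longrightarrow> 0 \<le> \<psi> s \<omega>"
    and z0: "\<And>s. 0 \<le> s \<Longrightarrow> s \<le> T \<Longrightarrow> 0 \<le> Z s \<omega>"
    using \<psi>(1) Z(1) \<omega> by (auto simp: nonneg_process_def)
  have z: "continuous_on {0..T} (\<lambda>s. Z s \<omega>)"
    using Z(3) \<omega> by (auto simp: continuous_paths_def intro: continuous_on_subset)
  show "continuous_on {0..T} (\<lambda>t. discounted t \<omega>)"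
    unfolding discounted_def weight_def
  proof (intro continuous_intros z)
    show "continuous_on {0..T} (\<lambda>t. enn2real (time_integral (\<lambda>s. \<psi> s \<omega>) t))"
      by (rule path_integrals(1)) (fact T f f0 fin z z0)+
  qed
  show "weight t \<omega> \<le> weight s \<omega>" if "0 \<le> s" "s \<le> t" "t \<le> T"
  proof -
    have "enn2real (time_integral (\<lambda>s. \<psi> s \<omega>) s) \<le> enn2real (time_integral (\<lambda>s. \<psi> s \<omega>) t)"
      by (rule path_integrals(5)[where T = T and z = "\<lambda>s. Z s \<omega>"]) (fact T f f0 fin z z0 that)+
    then show ?thesis by (simp add: weight_def)
  qed
  show "time_integral (\<lambda>s. \<psi> s \<omega> * Z s \<omega>) t
        = ennreal (enn2real (time_integral (\<lambda>s. \<psi> s \<omega> * Z s \<omega>) t))" if "0 \<le> t" "t \<le> T"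
    by (rule path_integrals(7)[where T = T]) (fact T f f0 fin z z0 that)+
qed

text \<open>On a path with finite integral this is \<open>discounted\<close> at time
  \<open>T\<close> after stopping on reaching \<open>c\<close>, with value \<open>c\<close> if the
  path starts above \<open>c\<close>. The \<open>min\<close> keeps it at most \<open>c\<close> on
  exceptional paths as well, where \<open>strictly_below\<close> does not control the value at an
  irrational \<open>T\<close>.\<close>

definition truncated_sup :: "real \<Rightarrow> real \<Rightarrow> 'a \<Rightarrow> real" where
  "truncated_sup c T \<omega> = (if strictly_below discounted c T \<omega> then min (discounted T \<omega>) c else c)"

lemma truncated_sup_measurable: "0 \<le> T \<Longrightarrow> truncated_sup c T \<in> borel_measurable P"
proof -
  assume T: "0 \<le> T"
  have [measurable]: "Measurable.pred P (strictly_below discounted c T)"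
    by (rule measurable_F_P[OF strictly_below_measurable]) (rule discounted_measurable)
  have [measurable]: "discounted T \<in> borel_measurable P"
    by (rule measurable_F_P[OF discounted_measurable[OF T]])
  show ?thesis unfolding truncated_sup_def[abs_def] by measurable
qed

lemma truncated_sup_bounds:
  "\<omega> \<in> space P \<Longrightarrow> 0 \<le> T \<Longrightarrow> 0 < c \<Longrightarrow> 0 \<le> truncated_sup c T \<omega> \<and> truncated_sup c T \<omega> \<le> c"
  using discounted_nonneg[of \<omega> T] by (auto simp: truncated_sup_def)

lemma running_sup_H: "0 \<le> T \<Longrightarrow> running_sup H T \<in> borel_measurable P"
  by (rule running_sup_measurable[OF H(2,3)])

lemma running_sup_H_upper: "\<omega> \<in> space P \<Longrightarrow> 0 \<le> s \<Longrightarrow> s \<le> T \<Longrightarrow> H s \<omega> \<le> running_sup H T \<omega>"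
  unfolding running_sup_def using H(3)
  by (intro cSUP_upper bounded_imp_bdd_above compact_imp_bounded compact_continuous_image)
    (auto simp: continuous_paths_def intro: continuous_on_subset)

lemma running_sup_H_nonneg: "\<omega> \<in> space P \<Longrightarrow> 0 \<le> T \<Longrightarrow> 0 \<le> running_sup H T \<omega>"
  using running_sup_H_upper[of \<omega> 0 T] H(1) by (force simp: nonneg_process_def)

text \<open>The domination property behind Lenglart's inequality. The grid estimate proves it on the
  event \<open>E n\<close> that the localising time is beyond \<open>T\<close> and
  \<open>\<bar>M\<bar>\<close> stays below \<open>n\<close>. Almost every path lies in
  \<open>E n\<close> for all large \<open>n\<close>, and the constant \<open>c\<close> dominates, so
  \<open>n\<close> can tend to infinity.\<close>

lemma truncated_bound:
  assumes T: "0 \<le> T" and c: "0 < c" and fin: "AE \<omega> in P. time_integral (\<lambda>s. \<psi> s \<omega>) T < \<infinity>"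
  shows "(\<integral> \<omega>. truncated_sup c T \<omega> * of_bool (running_sup H T \<omega> < c) \<partial>P)
     \<le> (\<integral> \<omega>. min (running_sup H T \<omega>) c \<partial>P)"
proof -
  let ?A = "running_sup H T"
  have contM: "\<And>\<omega>. \<omega> \<in> space P \<Longrightarrow> continuous_on {0..} (\<lambda>t. M t \<omega>)" and adM: "adapted F M"
    using M(1) by (auto simp: continuous_local_martingale_def continuous_paths_def)
  obtain \<tau> where \<tau>: "\<And>n. ext_stopping_time F (\<tau> n)" "AE \<omega> in P. (\<lambda>n. \<tau> n \<omega>) \<longlonglongrightarrow> \<infinity>"
    "\<And>n. martingale P F (stopped M (\<tau> n))"
    using M(1) unfolding continuous_local_martingale_def by (elim conjE exE) (auto elim: AE_mp)
  define E where "E n \<omega> \<longleftrightarrow> strictly_below (\<lambda>t \<omega>. \<bar>M t \<omega>\<bar>) (real n) T \<omega> \<and> \<not> \<tau> n \<omega> \<le> ennreal T" for n \<omega>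
  have mM: "(\<lambda>\<omega>. \<bar>M t \<omega>\<bar>) \<in> borel_measurable (F t)" if "0 \<le> t" for t
    using adM that by (auto simp: adapted_def)
  have mH: "H t \<in> borel_measurable (F t)" if "0 \<le> t" for t
    using H(2) that by (auto simp: adapted_def)
  have [measurable]: "Measurable.pred P (E n)" for n
  proof -
    have [measurable]: "Measurable.pred P (strictly_below (\<lambda>t \<omega>. \<bar>M t \<omega>\<bar>) (real n) T)"
      by (rule measurable_F_P[OF strictly_below_measurable]) (rule mM)
    have [measurable]: "Measurable.pred P (\<lambda>\<omega>. \<tau> n \<omega> \<le> ennreal T)"
      using \<tau>(1)[of n] T unfolding ext_stopping_time_def by (auto intro: measurable_F_P)
    show ?thesis unfolding E_def[abs_def] by measurable
  qed
  note [measurable] = truncated_sup_measurable[OF T] running_sup_H[OF T]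
  have D: "0 \<le> truncated_sup c T \<omega>" "truncated_sup c T \<omega> \<le> c" if "\<omega> \<in> space P" for \<omega>
    using truncated_sup_bounds[OF that T c] by auto
  have intD: "integrable P (\<lambda>\<omega>. truncated_sup c T \<omega> * of_bool (?A \<omega> < c) * of_bool (E n \<omega>))" for n
    by (rule integrable_const_bound[where B = c]) (use D c in \<open>auto intro!: AE_I2\<close>)
  have intA: "integrable P (\<lambda>\<omega>. min (?A \<omega>) c)"
    by (rule integrable_const_bound[where B = c]) (use running_sup_H_nonneg T c in \<open>auto intro!: AE_I2\<close>)
  have step: "(\<integral> \<omega>. truncated_sup c T \<omega> * of_bool (?A \<omega> < c) * of_bool (E n \<omega>) \<partial>P) \<le> (\<integral> \<omega>. min (?A \<omega>) c \<partial>P)" for n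
  proof -
    define G where "G t \<omega> \<longleftrightarrow> strictly_below (\<lambda>t \<omega>. \<bar>M t \<omega>\<bar>) (real n) t \<omega> \<and> strictly_below H c t \<omega> \<and> strictly_below discounted c t \<omega>" for t \<omega>
    define \<theta> where "\<theta> \<omega> = enn2real (min (ennreal T) (\<tau> n \<omega>))" for \<omega>
    have \<theta>: "0 \<le> \<theta> \<omega>" "\<theta> \<omega> \<le> T" for \<omega> using T by (auto simp: \<theta>_def intro!: enn2real_leI)
    have N: "stopped M (\<tau> n) t \<omega> = M (min t (\<theta> \<omega>)) \<omega>" if "0 \<le> t" "t \<le> T" for t \<omega>
      unfolding \<theta>_def by (rule stopped_eq[OF that])
    have G_iff: "G t \<omega> \<longleftrightarrow> (\<forall>s\<in>{0..t}. \<bar>M s \<omega>\<bar> < real n \<and> H s \<omega> < c \<and> discounted s \<omega> < c)"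
      if "\<omega> \<in> space P" "0 \<le> t" "t \<le> T" "time_integral (\<lambda>s. \<psi> s \<omega>) T < \<infinity>" for t \<omega>
    proof -
      have "continuous_on {0..t} (\<lambda>t. \<bar>M t \<omega>\<bar>)" "continuous_on {0..t} (\<lambda>t. H t \<omega>)"
        using contM[OF that(1)] H(3) that(1) unfolding continuous_paths_def
        by (auto intro!: continuous_intros intro: continuous_on_subset)
      moreover have "continuous_on {0..t} (\<lambda>t. discounted t \<omega>)"
        by (rule continuous_on_subset[OF good_path(1)[OF that(1) T that(4)]]) (use that in auto)
      ultimately show ?thesis using that(2) by (auto simp: G_def strictly_below_iff)
    qed
    \<comment> \<open>The indicator of \<open>E n\<close> multiplies only the first term, so off
      \<open>E n\<close> the integrand is \<open>- min A c\<close>. In this form the pathwise bound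
      holds almost everywhere, which Fatou's lemma requires.\<close>
    have "(\<integral> \<omega>. truncated_sup c T \<omega> * of_bool (?A \<omega> < c) * of_bool (E n \<omega>) - min (?A \<omega>) c \<partial>P) \<le> 0"
    proof (rule martingale_sum_fatou[where N = "stopped M (\<tau> n)" and T = T and n = "real n" and G = G and w = weight])
      show "continuous_on {0..T} (\<lambda>t. stopped M (\<tau> n) t \<omega>)" if "\<omega> \<in> space P" for \<omega>
      proof -
        have "continuous_on {0..T} (\<lambda>t. M (min t (\<theta> \<omega>)) \<omega>)"
          by (rule continuous_on_compose2[OF contM[OF that]]) (use \<theta> in \<open>auto intro!: continuous_intros\<close>)
        then show ?thesis by (simp add: N cong: continuous_on_cong_simp)
      qed
      show "Measurable.pred (F t) (G t)" if "0 \<le> t" "t \<le> T" for t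
        unfolding G_def[abs_def]
        by (intro pred_intros_logic strictly_below_measurable mM mH discounted_measurable)
      show "G s \<omega>" if "s \<le> t" "G t \<omega>" for s t \<omega>
        using that by (auto simp: G_def intro: strictly_below_antimono)
      show "weight t \<in> borel_measurable (F t)" if "0 \<le> t" "t \<le> T" for t
        using that by (intro weight_measurable)
      show "0 \<le> weight t \<omega>" "weight t \<omega> \<le> 1" for t \<omega> by (simp_all add: weight_def)
      show "AE \<omega> in P. \<forall>s t. 0 \<le> s \<longrightarrow> s \<le> t \<longrightarrow> t \<le> T \<longrightarrow> weight t \<omega> \<le> weight s \<omega>"
        using fin AE_space by eventually_elim (use good_path(2)[OF _ T] in blast)
      show "AE \<omega> in P. \<forall>t\<in>{0..T}. G t \<omega> \<longrightarrow> \<bar>stopped M (\<tau> n) t \<omega>\<bar> \<le> real n"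
        using fin AE_space
      proof eventually_elim
        case (elim \<omega>)
        show ?case
        proof (intro ballI impI)
          fix t assume t: "t \<in> {0..T}" "G t \<omega>"
          then have "min t (\<theta> \<omega>) \<in> {0..t}" using \<theta>[of \<omega>] by auto
          then have "\<bar>M (min t (\<theta> \<omega>)) \<omega>\<bar> < real n" using t elim G_iff[of \<omega> t] by auto
          then show "\<bar>stopped M (\<tau> n) t \<omega>\<bar> \<le> real n" using N[of t \<omega>] t by simp
        qed
      qed
      show "AE \<omega> in P. \<forall>e>0. \<exists>K0. \<forall>K\<ge>K0. truncated_sup c T \<omega> * of_bool (?A \<omega> < c) * of_bool (E n \<omega>) - min (?A \<omega>) c
         \<le> e + (\<Sum>j<K. weight (T * real j / real K) \<omega> * of_bool (G (T * real j / real K) \<omega>) *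
            (stopped M (\<tau> n) (T * real (Suc j) / real K) \<omega> - stopped M (\<tau> n) (T * real j / real K) \<omega>))"
        using fin AE_space M(2) gronwall
      proof eventually_elim
        case (elim \<omega>)
        note \<omega> = elim(2)
        show ?case
        proof (intro allI impI)
          fix e :: real assume e: "0 < e"
          have f: "(\<lambda>s. \<psi> s \<omega>) \<in> borel_measurable (restrict_space borel {0..T})"
            by (rule time_integral_measurable(2)[OF \<psi>(2) T \<omega>])
          have nonneg: "\<And>s. 0 \<le> s \<Longrightarrow> s \<le> T \<Longrightarrow> 0 \<le> \<psi> s \<omega>" "\<And>s. 0 \<le> s \<Longrightarrow> s \<le> T \<Longrightarrow> 0 \<le> Z s \<omega>"
            "\<And>s. 0 \<le> s \<Longrightarrow> s \<le> T \<Longrightarrow> 0 \<le> H s \<omega>"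
            using \<psi>(1) Z(1) H(1) \<omega> by (auto simp: nonneg_process_def)
          have cont: "continuous_on {0..T} (\<lambda>s. Z s \<omega>)" "continuous_on {0..T} (\<lambda>s. H s \<omega>)"
            "continuous_on {0..T} (\<lambda>s. M s \<omega>)"
            using Z(3) H(3) contM[OF \<omega>] \<omega> by (auto simp: continuous_paths_def intro: continuous_on_subset)
          have ineq: "Z t \<omega> \<le> enn2real (time_integral (\<lambda>s. \<psi> s \<omega> * Z s \<omega>) t) + M t \<omega> + H t \<omega>"
            if "0 \<le> t" "t \<le> T" for t
          proof -
            have "ereal (Z t \<omega>) \<le> enn2ereal (time_integral (\<lambda>s. \<psi> s \<omega> * Z s \<omega>) t) + ereal (M t \<omega>) + ereal (H t \<omega>)"
              using elim(4) that by blast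
            also have "time_integral (\<lambda>s. \<psi> s \<omega> * Z s \<omega>) t = ennreal (enn2real (time_integral (\<lambda>s. \<psi> s \<omega> * Z s \<omega>) t))"
              by (rule good_path(3)[OF \<omega> T elim(1) that])
            also have "enn2ereal \<dots> = ereal (enn2real (time_integral (\<lambda>s. \<psi> s \<omega> * Z s \<omega>) t))"
              by (simp add: enn2ereal_ennreal)
            finally show ?thesis by simp
          qed
          have E\<theta>: "\<theta> \<omega> = T \<and> (\<forall>s\<in>{0..T}. \<bar>M s \<omega>\<bar> < real n)" if "E n \<omega>"
          proof
            have "min (ennreal T) (\<tau> n \<omega>) = ennreal T" using that by (intro min_absorb1) (simp add: E_def not_le less_imp_le)
            then show "\<theta> \<omega> = T" using T by (simp add: \<theta>_def)
            have "continuous_on {0..T} (\<lambda>t. \<bar>M t \<omega>\<bar>)" by (intro continuous_intros cont)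
            then show "\<forall>s\<in>{0..T}. \<bar>M s \<omega>\<bar> < real n" using that T by (simp add: E_def strictly_below_iff)
          qed
          have trunc: "truncated_sup c T \<omega> = (if \<forall>s\<in>{0..T}. discounted s \<omega> < c then min (discounted T \<omega>) c else c)"
            unfolding truncated_sup_def strictly_below_iff[where Y = discounted, OF good_path(1)[OF \<omega> T elim(1)] T] ..
          have "\<exists>K0. \<forall>K\<ge>K0. truncated_sup c T \<omega> * of_bool (?A \<omega> < c) * of_bool (E n \<omega>) - min (?A \<omega>) c
            \<le> e + (\<Sum>j<K. weight (T * real j / real K) \<omega> *
              of_bool (\<forall>s\<in>{0..T * real j / real K}. \<bar>M s \<omega>\<bar> < real n \<and> H s \<omega> < c \<and> discounted s \<omega> < c) *
               (M (min (T * real (Suc j) / real K) (\<theta> \<omega>)) \<omega> - M (min (T * real j / real K) (\<theta> \<omega>)) \<omega>))"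
            unfolding trunc running_sup_def unfolding discounted_def weight_def
            by (rule pathwise_stopped_bound) (fact T f nonneg elim cont ineq c \<theta> E\<theta> e)+
          then obtain K0 where K0: "\<And>K. K \<ge> K0 \<Longrightarrow> truncated_sup c T \<omega> * of_bool (?A \<omega> < c) * of_bool (E n \<omega>) - min (?A \<omega>) c
            \<le> e + (\<Sum>j<K. weight (T * real j / real K) \<omega> *
              of_bool (\<forall>s\<in>{0..T * real j / real K}. \<bar>M s \<omega>\<bar> < real n \<and> H s \<omega> < c \<and> discounted s \<omega> < c) *
               (M (min (T * real (Suc j) / real K) (\<theta> \<omega>)) \<omega> - M (min (T * real j / real K) (\<theta> \<omega>)) \<omega>))"
            by blast
          show "\<exists>K0. \<forall>K\<ge>K0. truncated_sup c T \<omega> * of_bool (?A \<omega> < c) * of_bool (E n \<omega>) - min (?A \<omega>) c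
         \<le> e + (\<Sum>j<K. weight (T * real j / real K) \<omega> * of_bool (G (T * real j / real K) \<omega>) *
            (stopped M (\<tau> n) (T * real (Suc j) / real K) \<omega> - stopped M (\<tau> n) (T * real j / real K) \<omega>))"
          proof (intro exI[of _ K0] allI impI)
            fix K assume K: "K0 \<le> K"
            have "(\<Sum>j<K. weight (T * real j / real K) \<omega> * of_bool (G (T * real j / real K) \<omega>) *
              (stopped M (\<tau> n) (T * real (Suc j) / real K) \<omega> - stopped M (\<tau> n) (T * real j / real K) \<omega>))
             = (\<Sum>j<K. weight (T * real j / real K) \<omega> *
              of_bool (\<forall>s\<in>{0..T * real j / real K}. \<bar>M s \<omega>\<bar> < real n \<and> H s \<omega> < c \<and> discounted s \<omega> < c) *
               (M (min (T * real (Suc j) / real K) (\<theta> \<omega>)) \<omega> - M (min (T * real j / real K) (\<theta> \<omega>)) \<omega>))"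
            proof (intro sum.cong refl)
              fix j assume j: "j \<in> {..<K}"
              have "0 \<le> T * real i / real K" "T * real i / real K \<le> T" if "i \<le> K" for i
              proof -
                have "T * real i \<le> T * real K" using that T by (intro mult_left_mono) auto
                then show "0 \<le> T * real i / real K" "T * real i / real K \<le> T"
                  using T j by (auto simp: divide_le_eq)
              qed
              from this[of j] this[of "Suc j"] j show "weight (T * real j / real K) \<omega> * of_bool (G (T * real j / real K) \<omega>) *
              (stopped M (\<tau> n) (T * real (Suc j) / real K) \<omega> - stopped M (\<tau> n) (T * real j / real K) \<omega>)
              = weight (T * real j / real K) \<omega> *
              of_bool (\<forall>s\<in>{0..T * real j / real K}. \<bar>M s \<omega>\<bar> < real n \<and> H s \<omega> < c \<and> discounted s \<omega> < c) *
               (M (min (T * real (Suc j) / real K) (\<theta> \<omega>)) \<omega> - M (min (T * real j / real K) (\<theta> \<omega>)) \<omega>)"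
                by (simp only: N G_iff[OF \<omega> _ _ elim(1)] lessThan_iff Suc_leI less_imp_le)
            qed
            then show "truncated_sup c T \<omega> * of_bool (?A \<omega> < c) * of_bool (E n \<omega>) - min (?A \<omega>) c
              \<le> e + (\<Sum>j<K. weight (T * real j / real K) \<omega> * of_bool (G (T * real j / real K) \<omega>) *
               (stopped M (\<tau> n) (T * real (Suc j) / real K) \<omega> - stopped M (\<tau> n) (T * real j / real K) \<omega>))"
              using K0[OF K] by (simp only:)
          qed
        qed
      qed
    qed (use \<tau>(3) T intD intA in auto)
    then show ?thesis using intD intA by simp
  qed
  have "(\<lambda>n. \<integral> \<omega>. truncated_sup c T \<omega> * of_bool (?A \<omega> < c) * of_bool (E n \<omega>) \<partial>P)
     \<longlonglongrightarrow> (\<integral> \<omega>. truncated_sup c T \<omega> * of_bool (?A \<omega> < c) \<partial>P)"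
  proof (rule integral_dominated_convergence[where w = "\<lambda>_. c"])
    show "AE \<omega> in P. (\<lambda>n. truncated_sup c T \<omega> * of_bool (?A \<omega> < c) * of_bool (E n \<omega>))
      \<longlonglongrightarrow> truncated_sup c T \<omega> * of_bool (?A \<omega> < c)"
      using \<tau>(2) AE_space
    proof eventually_elim
      case (elim \<omega>)
      have contM': "continuous_on {0..T} (\<lambda>t. \<bar>M t \<omega>\<bar>)"
        using contM[OF elim(2)] by (auto intro!: continuous_intros intro: continuous_on_subset)
      then have "bounded ((\<lambda>t. \<bar>M t \<omega>\<bar>) ` {0..T})"
        by (intro compact_imp_bounded compact_continuous_image) auto
      then obtain k where k: "\<forall>t\<in>{0..T}. \<bar>M t \<omega>\<bar> \<le> k"
        unfolding bounded_iff by auto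
      have "\<forall>\<^sub>F n in sequentially. ennreal T < \<tau> n \<omega>"
        by (rule order_tendstoD[OF elim(1)]) simp
      moreover have "\<forall>\<^sub>F n in sequentially. k < real n"
        using filterlim_real_sequentially unfolding filterlim_at_top_dense by blast
      ultimately have "\<forall>\<^sub>F n in sequentially. E n \<omega>"
      proof eventually_elim
        case (elim n)
        then have "\<forall>s\<in>{0..T}. \<bar>M s \<omega>\<bar> < real n" using k by force
        then show ?case using elim contM' T by (simp add: E_def strictly_below_iff not_le)
      qed
      then have "\<forall>\<^sub>F n in sequentially. truncated_sup c T \<omega> * of_bool (?A \<omega> < c) * of_bool (E n \<omega>)
        = truncated_sup c T \<omega> * of_bool (?A \<omega> < c)"
        by eventually_elim simp
      then show ?case by (rule tendsto_eventually)
    qed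
  qed (use D c in \<open>auto intro!: AE_I2\<close>)
  then show ?thesis
    by (rule LIMSEQ_le_const2) (use step in auto)
qed

end

section \<open>Moments from tails\<close>

text \<open>Since \<open>sin (pi * p) = sin (pi * (1 - p))\<close>, the inequality
  \<open>sin x \<le> x\<close> can be used at both arguments. For \<open>p < 1/4\<close> the first
  makes the constant at least \<open>4\<close>, which exceeds \<open>1 / (1 - p)\<close>; otherwise
  the constant is \<open>pi / sin (pi * p)\<close> and the second applies.\<close>

lemma gronwall_const_ge:
  assumes p: "0 < p" "p < 1"
  shows "1 / (1 - p) \<le> gronwall_const p"
proof -
  have sin: "0 < sin (pi * p)" using p by (intro sin_gt_zero) auto
  have le: "sin (pi * p) \<le> pi * p" using p by (intro sin_x_le_x) auto
  have "sin (pi * p) = sin (pi * (1 - p))"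
    using sin_pi_minus[of "pi * p"] by (simp add: right_diff_distrib)
  also have "\<dots> \<le> pi * (1 - p)" using p by (intro sin_x_le_x) auto
  finally have le': "sin (pi * p) \<le> pi * (1 - p)" .
  show ?thesis
  proof (cases "p < 1/4")
    case True
    have "1 / (1 - p) \<le> 4" using True p by (simp add: divide_le_eq)
    also have "4 \<le> 4 * (pi * p / sin (pi * p))" using le sin by (simp add: le_divide_eq)
    also have "\<dots> = gronwall_const p"
    proof -
      have "min 4 (1 / p) = 4" using True p by (simp add: min_def le_divide_eq)
      then show ?thesis by (simp add: gronwall_const_def)
    qed
    finally show ?thesis .
  next
    case False
    then have "min 4 (1 / p) = 1 / p" using p by (intro min_absorb2) (simp add: divide_le_eq)
    then have "gronwall_const p = pi / sin (pi * p)" using p by (simp add: gronwall_const_def)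
    moreover have "1 / (1 - p) \<le> pi / sin (pi * p)"
      using p sin le' by (simp add: field_simps)
    ultimately show ?thesis by simp
  qed
qed

text \<open>Layer-cake formula. The strict and the non-strict form differ on a null set; they fit
  the events \<open>c < y\<close> and \<open>c \<le> a\<close> in the tail estimate.\<close>

lemma nn_integral_powr_layer:
  fixes y p :: real
  assumes y: "0 \<le> y" and p: "0 < p"
  shows "(\<integral>\<^sup>+ c. (if 0 < c \<and> c \<le> y then ennreal (p * c powr (p - 1)) else 0) \<partial>lborel) = ennreal (y powr p)"
    "(\<integral>\<^sup>+ c. (if 0 < c \<and> c < y then ennreal (p * c powr (p - 1)) else 0) \<partial>lborel) = ennreal (y powr p)"
proof -
  have "((\<lambda>c. p * c powr (p - 1)) has_integral (p * (y powr (p - 1 + 1) / (p - 1 + 1)))) {0..y}"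
    by (rule has_integral_mult_right[OF has_integral_powr_from_0]) (use y p in auto)
  from nn_integral_has_integral_lebesgue'[OF _ this]
  have I: "(\<integral>\<^sup>+ c. ennreal (p * c powr (p - 1)) * indicator {0..y} c \<partial>lborel) = ennreal (y powr p)"
    using p by simp
  have ae: "AE c in lborel. c \<noteq> 0 \<and> c \<noteq> y"
    using AE_lborel_singleton[of 0] AE_lborel_singleton[of y] by eventually_elim simp
  show "(\<integral>\<^sup>+ c. (if 0 < c \<and> c \<le> y then ennreal (p * c powr (p - 1)) else 0) \<partial>lborel) = ennreal (y powr p)"
    unfolding I[symmetric] by (rule nn_integral_cong_AE) (use ae in eventually_elim, auto simp: indicator_def)
  show "(\<integral>\<^sup>+ c. (if 0 < c \<and> c < y then ennreal (p * c powr (p - 1)) else 0) \<partial>lborel) = ennreal (y powr p)"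
    unfolding I[symmetric] by (rule nn_integral_cong_AE) (use ae in eventually_elim, auto simp: indicator_def)
qed

text \<open>Splitting at \<open>c = a\<close>, the lower part gives \<open>a powr p\<close> and the
  upper part \<open>p / (1 - p) * a powr p\<close>. Convergence of the latter at infinity is where
  \<open>p < 1\<close> enters, and the sum is the origin of \<open>1 / (1 - p)\<close>.\<close>

lemma nn_integral_min_layer:
  fixes a p :: real
  assumes a: "0 \<le> a" and p: "0 < p" "p < 1"
  shows "(\<integral>\<^sup>+ c. (if 0 < c then ennreal (p * c powr (p - 2) * min a c) else 0) \<partial>lborel)
    = ennreal (1 / (1 - p) * a powr p)"
proof (cases "a = 0")
  case True
  then show ?thesis using p by (simp add: min_def cong: if_cong)
next
  case False
  then have a: "0 < a" using a by simp
  have "((\<lambda>c. p * a * c powr (p - 2)) has_integral (p * a * (- (a powr (p - 2 + 1)) / (p - 2 + 1)))) {a..}"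
    by (rule has_integral_mult_right[OF has_integral_powr_to_inf]) (use a p in auto)
  from nn_integral_has_integral_lebesgue'[OF _ this]
  have "(\<integral>\<^sup>+ c. ennreal (p * a * c powr (p - 2)) * indicator {a..} c \<partial>lborel)
      = ennreal (p * a * (- (a powr (p - 2 + 1)) / (p - 2 + 1)))"
    using p a by simp
  also have "p * a * (- (a powr (p - 2 + 1)) / (p - 2 + 1)) = p / (1 - p) * a powr p"
  proof -
    have "- (a powr (p - 2 + 1)) / (p - 2 + 1) = a powr (p - 1) / (1 - p)"
      using p by (simp add: divide_simps) (simp add: algebra_simps)
    moreover have "a * a powr (p - 1) = a powr p" using a by (simp add: powr_diff)
    ultimately show ?thesis by (metis times_divide_eq_left times_divide_eq_right mult.assoc)
  qed
  finally have J: "(\<integral>\<^sup>+ c. ennreal (p * a * c powr (p - 2)) * indicator {a..} c \<partial>lborel) = ennreal (p / (1 - p) * a powr p)" .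
  have ae: "AE c in lborel. c \<noteq> a" by (rule AE_lborel_singleton)
  have "(\<integral>\<^sup>+ c. (if 0 < c then ennreal (p * c powr (p - 2) * min a c) else 0) \<partial>lborel)
    = (\<integral>\<^sup>+ c. (if 0 < c \<and> c \<le> a then ennreal (p * c powr (p - 1)) else 0)
       + ennreal (p * a * c powr (p - 2)) * indicator {a..} c \<partial>lborel)"
    using ae
  proof (intro nn_integral_cong_AE, eventually_elim)
    case (elim c)
    have "c powr (p - 2) * c = c powr (p - 1)" if "0 < c"
      using that powr_add[of c "p - 2" 1] by simp
    then show ?case using elim a by (auto simp: indicator_def min_def mult_ac)
  qed
  also have "\<dots> = ennreal (a powr p) + ennreal (p / (1 - p) * a powr p)"
    by (subst nn_integral_add) (use nn_integral_powr_layer(1)[of a p] J a p in auto)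
  also have "\<dots> = ennreal (a powr p + p / (1 - p) * a powr p)"
    using p by (intro ennreal_plus[symmetric]) auto
  also have "a powr p + p / (1 - p) * a powr p = 1 / (1 - p) * a powr p"
    using p by (simp add: field_simps)
  finally show ?thesis .
qed

text \<open>Tonelli's theorem on both sides. The left becomes the layer-cake formula for
  \<open>y powr p\<close>; on the right the two terms of the tail bound contribute the factors
  \<open>1 / (1 - p)\<close> and \<open>1\<close>. Every integrand takes values in [0,\<infinity>],
  so no moment has to be known to be finite.\<close>

lemma (in sigma_finite_measure) lenglart_moment:
  fixes y a :: "'a \<Rightarrow> real"
  assumes meas: "y \<in> borel_measurable M" "a \<in> borel_measurable M"
    and nonneg: "\<And>\<omega>. \<omega> \<in> space M \<Longrightarrow> 0 \<le> y \<omega>" "\<And>\<omega>. \<omega> \<in> space M \<Longrightarrow> 0 \<le> a \<omega>"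
    and p: "0 < p" "p < 1"
    and tail: "\<And>c. 0 < c \<Longrightarrow> ennreal c * emeasure M {\<omega> \<in> space M. c < y \<omega>}
        \<le> (\<integral>\<^sup>+ \<omega>. ennreal (min (a \<omega>) c) \<partial>M) + ennreal c * emeasure M {\<omega> \<in> space M. c \<le> a \<omega>}"
  shows "(\<integral>\<^sup>+ \<omega>. ennreal (y \<omega> powr p) \<partial>M) \<le> ennreal (1 / (1 - p) + 1) * (\<integral>\<^sup>+ \<omega>. ennreal (a \<omega> powr p) \<partial>M)"
proof -
  note [measurable] = meas
  interpret L: pair_sigma_finite lborel M
    by (simp add: pair_sigma_finite_def sigma_finite_lborel sigma_finite_measure_axioms)
  let ?k = "\<lambda>c. ennreal (p * c powr (p - 1))"
  let ?g = "\<lambda>c \<omega>. (if 0 < c then ennreal (p * c powr (p - 2) * min (a \<omega>) c) else 0)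
     + (if 0 < c \<and> c \<le> a \<omega> then ?k c else 0)"
  have "(\<integral>\<^sup>+ \<omega>. ennreal (y \<omega> powr p) \<partial>M) = (\<integral>\<^sup>+ \<omega>. (\<integral>\<^sup>+ c. (if 0 < c \<and> c < y \<omega> then ?k c else 0) \<partial>lborel) \<partial>M)"
    using nonneg(1) p by (intro nn_integral_cong) (simp add: nn_integral_powr_layer(2))
  also have "\<dots> = (\<integral>\<^sup>+ c. (\<integral>\<^sup>+ \<omega>. (if 0 < c \<and> c < y \<omega> then ?k c else 0) \<partial>M) \<partial>lborel)"
    by (rule L.Fubini') measurable
  also have "\<dots> \<le> (\<integral>\<^sup>+ c. (\<integral>\<^sup>+ \<omega>. ?g c \<omega> \<partial>M) \<partial>lborel)"
  proof (rule nn_integral_mono)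
    fix c :: real
    show "(\<integral>\<^sup>+ \<omega>. (if 0 < c \<and> c < y \<omega> then ?k c else 0) \<partial>M) \<le> (\<integral>\<^sup>+ \<omega>. ?g c \<omega> \<partial>M)"
    proof (cases "0 < c")
      case True
      let ?w = "ennreal (p * c powr (p - 2))"
      have k: "?k c = ?w * ennreal c"
      proof -
        have "c powr (p - 1) = c powr (p - 2) * c" using True powr_add[of c "p - 2" 1] by simp
        then show ?thesis using True p by (simp add: mult.assoc flip: ennreal_mult)
      qed
      have "(\<integral>\<^sup>+ \<omega>. (if 0 < c \<and> c < y \<omega> then ?k c else 0) \<partial>M) = (\<integral>\<^sup>+ \<omega>. ?k c * indicator {\<omega> \<in> space M. c < y \<omega>} \<omega> \<partial>M)"
        using True by (intro nn_integral_cong) (auto simp: indicator_def)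
      also have "\<dots> = ?w * (ennreal c * emeasure M {\<omega> \<in> space M. c < y \<omega>})"
        by (subst nn_integral_cmult_indicator) (simp_all add: k mult.assoc)
      also have "\<dots> \<le> ?w * ((\<integral>\<^sup>+ \<omega>. ennreal (min (a \<omega>) c) \<partial>M) + ennreal c * emeasure M {\<omega> \<in> space M. c \<le> a \<omega>})"
        by (intro mult_left_mono tail True) simp
      also have "\<dots> = (\<integral>\<^sup>+ \<omega>. ?w * ennreal (min (a \<omega>) c) \<partial>M) + (\<integral>\<^sup>+ \<omega>. ?k c * indicator {\<omega> \<in> space M. c \<le> a \<omega>} \<omega> \<partial>M)"
        by (simp add: distrib_left nn_integral_cmult nn_integral_cmult_indicator k mult.assoc)
      also have "\<dots> = (\<integral>\<^sup>+ \<omega>. ?w * ennreal (min (a \<omega>) c) + ?k c * indicator {\<omega> \<in> space M. c \<le> a \<omega>} \<omega> \<partial>M)"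
        by (rule nn_integral_add[symmetric]) measurable
      also have "\<dots> = (\<integral>\<^sup>+ \<omega>. ?g c \<omega> \<partial>M)"
        using True nonneg(2) p by (intro nn_integral_cong) (auto simp: indicator_def simp flip: ennreal_mult)
      finally show ?thesis .
    qed simp
  qed
  also have "\<dots> = (\<integral>\<^sup>+ \<omega>. (\<integral>\<^sup>+ c. ?g c \<omega> \<partial>lborel) \<partial>M)"
    by (rule L.Fubini'[symmetric]) measurable
  also have "\<dots> = (\<integral>\<^sup>+ \<omega>. ennreal (1 / (1 - p) + 1) * ennreal (a \<omega> powr p) \<partial>M)"
  proof (rule nn_integral_cong)
    fix \<omega> assume \<omega>: "\<omega> \<in> space M"
    have "(\<integral>\<^sup>+ c. ?g c \<omega> \<partial>lborel) = ennreal (1 / (1 - p) * a \<omega> powr p) + ennreal (a \<omega> powr p)"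
      by (subst nn_integral_add)
        (use nn_integral_min_layer[OF nonneg(2)[OF \<omega>] p] nn_integral_powr_layer(1)[OF nonneg(2)[OF \<omega>] p(1)] in auto)
    also have "\<dots> = ennreal (1 / (1 - p) + 1) * ennreal (a \<omega> powr p)"
      using p by (simp add: distrib_right flip: ennreal_mult ennreal_plus)
    finally show "(\<integral>\<^sup>+ c. ?g c \<omega> \<partial>lborel) = ennreal (1 / (1 - p) + 1) * ennreal (a \<omega> powr p)" .
  qed
  also have "\<dots> = ennreal (1 / (1 - p) + 1) * (\<integral>\<^sup>+ \<omega>. ennreal (a \<omega> powr p) \<partial>M)"
    by (rule nn_integral_cmult) measurable
  finally show ?thesis .
qed

section \<open>Powers on [0,\<infinity>] and Hoelder's inequality\<close>

lemma powr_ennreal_mono: "x \<le> y \<Longrightarrow> 0 \<le> a \<Longrightarrow> powr_ennreal x a \<le> powr_ennreal y a"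
  by (auto simp: powr_ennreal_def top_unique intro!: ennreal_leI powr_mono2 enn2real_mono simp: less_top)

lemma powr_ennreal_mult:
  assumes "0 < C"
  shows "powr_ennreal (ennreal C * x) a = ennreal (C powr a) * powr_ennreal x a"
proof (cases "x = \<infinity>")
  case True
  then show ?thesis using assms by (simp add: powr_ennreal_def ennreal_mult_top)
next
  case False
  then show ?thesis using assms
    by (simp add: powr_ennreal_def enn2real_mult powr_mult ennreal_mult_eq_top_iff flip: ennreal_mult)
qed

lemma powr_ennreal_eq_0_iff: "powr_ennreal x a = 0 \<longleftrightarrow> x = 0"
  by (auto simp: powr_ennreal_def enn2real_eq_0_iff ennreal_eq_0_iff)

text \<open>Young's inequality for \<open>f\<close> and \<open>g\<close> divided by their norms, if
  these are positive and finite. If a norm is zero, the product \<open>f * g\<close> vanishes almost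
  everywhere, in agreement with \<open>0 * \<infinity> = 0\<close>; in the remaining case the
  right-hand side is infinite.\<close>

lemma nn_integral_Holder:
  fixes f g :: "'a \<Rightarrow> real"
  assumes meas: "f \<in> borel_measurable M" "g \<in> borel_measurable M"
    and nonneg: "\<And>x. 0 \<le> f x" "\<And>x. 0 \<le> g x"
    and exps: "1 < \<mu>" "1 < \<nu>" "1 / \<mu> + 1 / \<nu> = 1"
  shows "(\<integral>\<^sup>+ x. ennreal (f x * g x) \<partial>M) \<le> powr_ennreal (\<integral>\<^sup>+ x. ennreal (f x powr \<mu>) \<partial>M) (1 / \<mu>)
     * powr_ennreal (\<integral>\<^sup>+ x. ennreal (g x powr \<nu>) \<partial>M) (1 / \<nu>)"
proof -
  note [measurable] = meas
  define A where "A = (\<integral>\<^sup>+ x. ennreal (f x powr \<mu>) \<partial>M)"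
  define B where "B = (\<integral>\<^sup>+ x. ennreal (g x powr \<nu>) \<partial>M)"
  have "(\<integral>\<^sup>+ x. ennreal (f x * g x) \<partial>M) = 0" if "A = 0 \<or> B = 0"
  proof -
    have "AE x in M. f x = 0 \<or> g x = 0"
      using that
    proof
      assume "A = 0"
      then have "AE x in M. ennreal (f x powr \<mu>) = 0"
        unfolding A_def by (subst (asm) nn_integral_0_iff_AE) auto
      then show ?thesis by eventually_elim (simp add: ennreal_eq_0_iff)
    next
      assume "B = 0"
      then have "AE x in M. ennreal (g x powr \<nu>) = 0"
        unfolding B_def by (subst (asm) nn_integral_0_iff_AE) auto
      then show ?thesis by eventually_elim (simp add: ennreal_eq_0_iff)
    qed
    then have "AE x in M. ennreal (f x * g x) = 0" by eventually_elim auto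
    then show ?thesis by (subst nn_integral_0_iff_AE) auto
  qed
  moreover have "powr_ennreal A (1/\<mu>) * powr_ennreal B (1/\<nu>) = \<infinity>" if "A \<noteq> 0" "B \<noteq> 0" "A = \<infinity> \<or> B = \<infinity>"
    using that by (auto simp: ennreal_mult_eq_top_iff powr_ennreal_eq_0_iff) (simp_all add: powr_ennreal_def)
  moreover have "(\<integral>\<^sup>+ x. ennreal (f x * g x) \<partial>M) \<le> powr_ennreal A (1/\<mu>) * powr_ennreal B (1/\<nu>)"
    if fin: "A \<noteq> 0" "B \<noteq> 0" "A \<noteq> \<infinity>" "B \<noteq> \<infinity>"
  proof -
    define \<alpha> where "\<alpha> = enn2real A"
    define \<beta> where "\<beta> = enn2real B"
    have \<alpha>: "0 < \<alpha>" "A = ennreal \<alpha>" and \<beta>: "0 < \<beta>" "B = ennreal \<beta>"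
      using fin by (auto simp: \<alpha>_def \<beta>_def enn2real_positive_iff less_top zero_less_iff_neq_zero)
    define a where "a = \<alpha> powr (1/\<mu>)"
    define b where "b = \<beta> powr (1/\<nu>)"
    have ab: "0 < a" "0 < b" "a powr \<mu> = \<alpha>" "b powr \<nu> = \<beta>"
      using \<alpha> \<beta> exps by (simp_all add: a_def b_def powr_powr)
    have "(\<integral>\<^sup>+ x. ennreal (f x * g x) \<partial>M)
      \<le> (\<integral>\<^sup>+ x. ennreal (a * b / \<mu> / \<alpha>) * ennreal (f x powr \<mu>) + ennreal (a * b / \<nu> / \<beta>) * ennreal (g x powr \<nu>) \<partial>M)"
    proof (rule nn_integral_mono)
      fix x
      have "(f x / a) * (g x / b) \<le> (f x / a) powr \<mu> / \<mu> + (g x / b) powr \<nu> / \<nu>"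
        using exps ab nonneg by (intro Youngs_inequality) auto
      also have "\<dots> = f x powr \<mu> / \<alpha> / \<mu> + g x powr \<nu> / \<beta> / \<nu>"
        using ab nonneg by (simp add: powr_divide)
      finally have "a * b * ((f x / a) * (g x / b)) \<le> a * b * (f x powr \<mu> / \<alpha> / \<mu> + g x powr \<nu> / \<beta> / \<nu>)"
        using ab by (intro mult_left_mono) auto
      then have "f x * g x \<le> a * b / \<mu> / \<alpha> * f x powr \<mu> + a * b / \<nu> / \<beta> * g x powr \<nu>"
        using ab by (simp add: field_simps)
      then have "ennreal (f x * g x) \<le> ennreal (a * b / \<mu> / \<alpha> * f x powr \<mu> + a * b / \<nu> / \<beta> * g x powr \<nu>)"
        by (rule ennreal_leI)
      also have "\<dots> = ennreal (a * b / \<mu> / \<alpha>) * ennreal (f x powr \<mu>) + ennreal (a * b / \<nu> / \<beta>) * ennreal (g x powr \<nu>)"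
        using ab exps \<alpha> \<beta> by (simp flip: ennreal_mult ennreal_plus)
      finally show "ennreal (f x * g x) \<le> \<dots>" .
    qed
    also have "\<dots> = ennreal (a * b / \<mu> / \<alpha>) * A + ennreal (a * b / \<nu> / \<beta>) * B"
      unfolding A_def B_def by (subst nn_integral_add) (simp_all add: nn_integral_cmult)
    also have "\<dots> = ennreal (a * b / \<mu> / \<alpha> * \<alpha> + a * b / \<nu> / \<beta> * \<beta>)"
      unfolding \<alpha>(2) \<beta>(2) using ab exps \<alpha>(1) \<beta>(1) by (simp flip: ennreal_mult ennreal_plus)
    also have "a * b / \<mu> / \<alpha> * \<alpha> + a * b / \<nu> / \<beta> * \<beta> = a * b * (1 / \<mu> + 1 / \<nu>)"
      using \<alpha>(1) \<beta>(1) by (simp add: distrib_left)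
    also have "\<dots> = a * b" by (simp add: exps)
    also have "ennreal (a * b) = powr_ennreal A (1/\<mu>) * powr_ennreal B (1/\<nu>)"
      using \<alpha> \<beta> ab by (simp add: powr_ennreal_def a_def b_def ennreal_mult)
    finally show ?thesis .
  qed
  ultimately show ?thesis unfolding A_def[symmetric] B_def[symmetric] by (metis top_greatest infinity_ennreal_def zero_le)
qed

section \<open>Moment bounds for the process\<close>

lemma gronwall_const_pos: "0 < p \<Longrightarrow> p < 1 \<Longrightarrow> 0 < gronwall_const p"
  using gronwall_const_ge[of p] by (smt (verit) divide_pos_pos)

lemma exp_ennreal_ennreal: "0 \<le> x \<Longrightarrow> exp_ennreal (ennreal x) = ennreal (exp x)"
  by (simp add: exp_ennreal_def)

lemma exp_ennreal_measurable: "exp_ennreal \<in> borel_measurable borel"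
  unfolding exp_ennreal_def[abs_def] by measurable

context stochastic_gronwall
begin

lemma nn_truncated_bound:
  assumes T: "0 \<le> T" and c: "0 < c" and fin: "AE \<omega> in P. time_integral (\<lambda>s. \<psi> s \<omega>) T < \<infinity>"
  shows "(\<integral>\<^sup>+ \<omega>. ennreal (truncated_sup c T \<omega> * of_bool (running_sup H T \<omega> < c)) \<partial>P)
     \<le> (\<integral>\<^sup>+ \<omega>. ennreal (min (running_sup H T \<omega>) c) \<partial>P)"
proof -
  note [measurable] = truncated_sup_measurable[OF T] running_sup_H[OF T]
  note D = truncated_sup_bounds[OF _ T c] and A = running_sup_H_nonneg[OF _ T]
  have "(\<integral>\<^sup>+ \<omega>. ennreal (truncated_sup c T \<omega> * of_bool (running_sup H T \<omega> < c)) \<partial>P)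
     = ennreal (\<integral> \<omega>. truncated_sup c T \<omega> * of_bool (running_sup H T \<omega> < c) \<partial>P)"
    by (intro nn_integral_eq_integral integrable_const_bound[where B = c] AE_I2) (use D c in auto)
  also have "\<dots> \<le> ennreal (\<integral> \<omega>. min (running_sup H T \<omega>) c \<partial>P)"
    by (intro ennreal_leI truncated_bound T c fin)
  also have "\<dots> = (\<integral>\<^sup>+ \<omega>. ennreal (min (running_sup H T \<omega>) c) \<partial>P)"
    by (intro nn_integral_eq_integral[symmetric] integrable_const_bound[where B = c] AE_I2) (use A c in auto)
  finally show ?thesis .
qed

text \<open>The moment bound degenerates as \<open>p\<close> tends to \<open>1\<close>, so the first
  moment is obtained directly: the level \<open>c\<close> runs through the positive integers. On
  almost every path, \<open>discounted\<close> and \<open>H\<^sup>*\<close> are eventually below the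
  level, and then the truncated quantity is \<open>discounted T\<close> itself. Fatou's lemma
  concludes.\<close>

lemma expectation_discounted:
  assumes T: "0 \<le> T" and fin: "AE \<omega> in P. time_integral (\<lambda>s. \<psi> s \<omega>) T < \<infinity>"
  shows "(\<integral>\<^sup>+ \<omega>. ennreal (discounted T \<omega>) \<partial>P) \<le> (\<integral>\<^sup>+ \<omega>. ennreal (running_sup H T \<omega>) \<partial>P)"
proof -
  let ?D = "\<lambda>k \<omega>. ennreal (truncated_sup (real (Suc k)) T \<omega> * of_bool (running_sup H T \<omega> < real (Suc k)))"
  note [measurable] = truncated_sup_measurable[OF T] running_sup_H[OF T]
  have "(\<integral>\<^sup>+ \<omega>. ennreal (discounted T \<omega>) \<partial>P) \<le> (\<integral>\<^sup>+ \<omega>. liminf (\<lambda>k. ?D k \<omega>) \<partial>P)"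
  proof (rule nn_integral_mono_AE)
    show "AE \<omega> in P. ennreal (discounted T \<omega>) \<le> liminf (\<lambda>k. ?D k \<omega>)"
      using fin AE_space
    proof eventually_elim
      case (elim \<omega>)
      have cont: "continuous_on {0..T} (\<lambda>t. discounted t \<omega>)" by (rule good_path(1)[OF elim(2) T elim(1)])
      then have "bounded ((\<lambda>t. discounted t \<omega>) ` {0..T})"
        by (intro compact_imp_bounded compact_continuous_image) auto
      then obtain b where b: "\<forall>t\<in>{0..T}. norm (discounted t \<omega>) \<le> b"
        unfolding bounded_iff by auto
      have "\<forall>\<^sub>F k in sequentially. max b (running_sup H T \<omega>) < real k"
        using filterlim_real_sequentially unfolding filterlim_at_top_dense by blast
      then have "\<forall>\<^sub>F k in sequentially. ennreal (discounted T \<omega>) \<le> ?D k \<omega>"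
      proof eventually_elim
        case (elim k)
        have "\<forall>s\<in>{0..T}. discounted s \<omega> < real (Suc k)" using b elim by force
        then have "strictly_below discounted (real (Suc k)) T \<omega>" "discounted T \<omega> < real (Suc k)"
          using T by (simp_all add: strictly_below_iff[where Y = discounted, OF cont T])
        then show ?case using elim by (simp add: truncated_sup_def)
      qed
      then show ?case by (rule Liminf_bounded)
    qed
  qed
  also have "\<dots> \<le> liminf (\<lambda>k. \<integral>\<^sup>+ \<omega>. ?D k \<omega> \<partial>P)"
    by (rule nn_integral_liminf) measurable
  also have "\<dots> \<le> (\<integral>\<^sup>+ \<omega>. ennreal (running_sup H T \<omega>) \<partial>P)"
  proof (rule Liminf_le)
    show "\<forall>\<^sub>F k in sequentially. (\<integral>\<^sup>+ \<omega>. ?D k \<omega> \<partial>P) \<le> (\<integral>\<^sup>+ \<omega>. ennreal (running_sup H T \<omega>) \<partial>P)"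
    proof (rule always_eventually, rule allI)
      fix k
      have "(\<integral>\<^sup>+ \<omega>. ?D k \<omega> \<partial>P) \<le> (\<integral>\<^sup>+ \<omega>. ennreal (min (running_sup H T \<omega>) (real (Suc k))) \<partial>P)"
        by (rule nn_truncated_bound[OF T _ fin]) simp
      also have "\<dots> \<le> (\<integral>\<^sup>+ \<omega>. ennreal (running_sup H T \<omega>) \<partial>P)"
        by (intro nn_integral_mono ennreal_leI) simp
      finally show "(\<integral>\<^sup>+ \<omega>. ?D k \<omega> \<partial>P) \<le> (\<integral>\<^sup>+ \<omega>. ennreal (running_sup H T \<omega>) \<partial>P)" .
    qed
  qed simp
  finally show ?thesis .
qed

text \<open>
  The junk value \<open>enn2real \<infinity> = 0\<close> can occur only on the null set where \<open>\<Psi>\<close> is infinite.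
\<close>
definition sup_discounted :: "real \<Rightarrow> 'a \<Rightarrow> real" where
  "sup_discounted T \<omega> = enn2real (SUP q\<in>{0..T} \<inter> \<rat>. ennreal (discounted q \<omega>))"

lemma sup_discounted_measurable: "0 \<le> T \<Longrightarrow> sup_discounted T \<in> borel_measurable P"
proof -
  have [measurable]: "discounted q \<in> borel_measurable P" if "q \<in> {0..T} \<inter> \<rat>" for q
    using that by (auto intro: measurable_F_P discounted_measurable)
  have "countable ({0..T} \<inter> \<rat>)" using countable_rat by (rule countable_subset[rotated]) auto
  then have "(\<lambda>\<omega>. SUP q\<in>{0..T} \<inter> \<rat>. ennreal (discounted q \<omega>)) \<in> borel_measurable P"
    by (rule borel_measurable_SUP) measurable
  then show ?thesis unfolding sup_discounted_def[abs_def] by measurable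
qed

lemma sup_discounted_nonneg: "0 \<le> sup_discounted T \<omega>"
  by (simp add: sup_discounted_def)

lemma sup_discounted_upper:
  assumes \<omega>: "\<omega> \<in> space P" and s: "0 \<le> s" "s \<le> T" and fin: "time_integral (\<lambda>s. \<psi> s \<omega>) T < \<infinity>"
  shows "discounted s \<omega> \<le> sup_discounted T \<omega>"
proof -
  have T: "0 \<le> T" using s by simp
  have cont: "continuous_on {0..T} (\<lambda>t. discounted t \<omega>)" by (rule good_path(1)[OF \<omega> T fin])
  then have "bounded ((\<lambda>t. discounted t \<omega>) ` {0..T})"
    by (intro compact_imp_bounded compact_continuous_image) auto
  then obtain b where b: "\<forall>t\<in>{0..T}. norm (discounted t \<omega>) \<le> b"
    unfolding bounded_iff by auto
  have "(SUP q\<in>{0..T} \<inter> \<rat>. ennreal (discounted q \<omega>)) \<le> ennreal b"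
    using b by (intro SUP_least ennreal_leI) (metis IntD1 abs_ge_self order_trans real_norm_def)
  then have top: "(SUP q\<in>{0..T} \<inter> \<rat>. ennreal (discounted q \<omega>)) < \<top>" by (simp add: le_less_trans)
  show ?thesis
  proof (rule le_of_rational_le[OF cont])
    fix q assume q: "q \<in> {0..T} \<inter> \<rat>"
    have "discounted q \<omega> = enn2real (ennreal (discounted q \<omega>))" using discounted_nonneg[OF \<omega>, of q] q by simp
    also have "\<dots> \<le> sup_discounted T \<omega>"
      unfolding sup_discounted_def using q top by (intro enn2real_mono SUP_upper) auto
    finally show "discounted q \<omega> \<le> sup_discounted T \<omega>" .
  qed (use s in auto)
qed

text \<open>Markov's inequality for the truncated supremum, which equals \<open>c\<close> wherever
  the supremum exceeds \<open>c\<close>. The event \<open>c \<le> H\<^sup>*\<close>, on which the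
  truncated bound says nothing, is kept as a separate term.\<close>

lemma sup_discounted_tail:
  assumes T: "0 \<le> T" and c: "0 < c" and fin: "AE \<omega> in P. time_integral (\<lambda>s. \<psi> s \<omega>) T < \<infinity>"
  shows "ennreal c * emeasure P {\<omega> \<in> space P. c < sup_discounted T \<omega>}
    \<le> (\<integral>\<^sup>+ \<omega>. ennreal (min (running_sup H T \<omega>) c) \<partial>P) + ennreal c * emeasure P {\<omega> \<in> space P. c \<le> running_sup H T \<omega>}"
proof -
  note [measurable] = truncated_sup_measurable[OF T] running_sup_H[OF T] sup_discounted_measurable[OF T]
  let ?B = "{\<omega> \<in> space P. c \<le> running_sup H T \<omega>}"
  have "ennreal c * emeasure P {\<omega> \<in> space P. c < sup_discounted T \<omega>}
     = (\<integral>\<^sup>+ \<omega>. ennreal c * indicator {\<omega> \<in> space P. c < sup_discounted T \<omega>} \<omega> \<partial>P)"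
    by (subst nn_integral_cmult_indicator) auto
  also have "\<dots> \<le> (\<integral>\<^sup>+ \<omega>. ennreal (truncated_sup c T \<omega> * of_bool (running_sup H T \<omega> < c))
      + ennreal c * indicator ?B \<omega> \<partial>P)"
  proof (rule nn_integral_mono)
    fix \<omega> assume \<omega>: "\<omega> \<in> space P"
    have "\<not> strictly_below discounted c T \<omega>" if "c < sup_discounted T \<omega>"
    proof
      assume "strictly_below discounted c T \<omega>"
      then obtain k :: nat where k: "\<And>q. q \<in> {0..T} \<inter> \<rat> \<Longrightarrow> discounted q \<omega> \<le> c - 1 / real (Suc k)"
        unfolding strictly_below_def by blast
      have "discounted q \<omega> \<le> c" if "q \<in> {0..T} \<inter> \<rat>" for q
        using k[OF that] by (smt (verit) divide_nonneg_nonneg of_nat_0_le_iff)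
      then have "(SUP q\<in>{0..T} \<inter> \<rat>. ennreal (discounted q \<omega>)) \<le> ennreal c"
        by (intro SUP_least ennreal_leI)
      then have "sup_discounted T \<omega> \<le> c" unfolding sup_discounted_def using c by (intro enn2real_leI) auto
      with that show False by simp
    qed
    then show "ennreal c * indicator {\<omega> \<in> space P. c < sup_discounted T \<omega>} \<omega>
      \<le> ennreal (truncated_sup c T \<omega> * of_bool (running_sup H T \<omega> < c)) + ennreal c * indicator ?B \<omega>"
      using \<omega> by (auto simp: indicator_def truncated_sup_def)
  qed
  also have "\<dots> = (\<integral>\<^sup>+ \<omega>. ennreal (truncated_sup c T \<omega> * of_bool (running_sup H T \<omega> < c)) \<partial>P)
      + ennreal c * emeasure P ?B"
    by (subst nn_integral_add) (auto simp: nn_integral_cmult_indicator)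
  also have "\<dots> \<le> (\<integral>\<^sup>+ \<omega>. ennreal (min (running_sup H T \<omega>) c) \<partial>P) + ennreal c * emeasure P ?B"
    by (intro add_right_mono nn_truncated_bound T c fin)
  finally show ?thesis .
qed

lemma sup_discounted_moment:
  assumes T: "0 \<le> T" and fin: "AE \<omega> in P. time_integral (\<lambda>s. \<psi> s \<omega>) T < \<infinity>" and p: "0 < p" "p < 1"
  shows "(\<integral>\<^sup>+ \<omega>. ennreal (sup_discounted T \<omega> powr p) \<partial>P)
    \<le> ennreal (gronwall_const p + 1) * (\<integral>\<^sup>+ \<omega>. ennreal (running_sup H T \<omega> powr p) \<partial>P)"
proof -
  have "(\<integral>\<^sup>+ \<omega>. ennreal (sup_discounted T \<omega> powr p) \<partial>P)
    \<le> ennreal (1 / (1 - p) + 1) * (\<integral>\<^sup>+ \<omega>. ennreal (running_sup H T \<omega> powr p) \<partial>P)"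
    by (intro lenglart_moment sup_discounted_measurable running_sup_H sup_discounted_nonneg running_sup_H_nonneg p sup_discounted_tail T fin)
  also have "\<dots> \<le> ennreal (gronwall_const p + 1) * (\<integral>\<^sup>+ \<omega>. ennreal (running_sup H T \<omega> powr p) \<partial>P)"
    using gronwall_const_ge[OF p] by (intro mult_right_mono ennreal_leI) auto
  finally show ?thesis .
qed

section \<open>Removing the discount factor\<close>

lemma Z_eq: "Z t \<omega> = exp (enn2real (time_integral (\<lambda>s. \<psi> s \<omega>) t)) * discounted t \<omega>"
  by (simp add: discounted_def weight_def flip: mult.assoc exp_add)

lemma sup_Z_le:
  assumes \<omega>: "\<omega> \<in> space P" and T: "0 \<le> T" and fin: "time_integral (\<lambda>s. \<psi> s \<omega>) T < \<infinity>" and p: "0 < p"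
  shows "(SUP s\<in>{0..T}. Z s \<omega> powr p) \<le> exp (p * enn2real (time_integral (\<lambda>s. \<psi> s \<omega>) T)) * sup_discounted T \<omega> powr p"
proof (rule cSUP_least)
  fix s assume s: "s \<in> {0..T}"
  let ?\<Psi> = "\<lambda>t. enn2real (time_integral (\<lambda>s. \<psi> s \<omega>) t)"
  have "?\<Psi> s \<le> ?\<Psi> T" using good_path(2)[OF \<omega> T fin, of s T] s by (simp add: weight_def)
  then have "Z s \<omega> \<le> exp (?\<Psi> T) * sup_discounted T \<omega>"
    unfolding Z_eq[of s] using sup_discounted_upper[OF \<omega> _ _ fin, of s] discounted_nonneg[OF \<omega>, of s] s
    by (intro mult_mono) auto
  then have "Z s \<omega> powr p \<le> (exp (?\<Psi> T) * sup_discounted T \<omega>) powr p"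
    using Z(1) \<omega> s p by (intro powr_mono2) (auto simp: nonneg_process_def)
  also have "\<dots> = exp (p * ?\<Psi> T) * sup_discounted T \<omega> powr p"
    by (simp add: powr_mult sup_discounted_nonneg exp_powr_real mult.commute)
  finally show "Z s \<omega> powr p \<le> exp (p * ?\<Psi> T) * sup_discounted T \<omega> powr p" .
qed (use T in auto)

text \<open>Hoelder's inequality gives the exponent \<open>\<mu>\<close> to the exponential and
  \<open>\<nu>\<close> to the discounted supremum, so the moment bound is needed at
  \<open>p * \<nu>\<close>, which must be below \<open>1\<close>. The constant of that bound sits
  inside the second norm, hence its power \<open>1 / \<nu>\<close>.\<close>

lemma random_bound:
  assumes T: "0 \<le> T" and p: "0 < p" and exps: "1 < \<mu>" "1 < \<nu>" "1 / \<mu> + 1 / \<nu> = 1" and p\<nu>: "p * \<nu> < 1"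
    and cond: "(AE \<omega> in P. time_integral (\<lambda>s. \<psi> s \<omega>) T < \<infinity>) \<or>
         (\<integral>\<^sup>+ \<omega>. ennreal (running_sup H T \<omega> powr (p * \<nu>)) \<partial>P) \<noteq> 0"
  shows "(\<integral>\<^sup>+ \<omega>. ennreal (SUP s\<in>{0..T}. Z s \<omega> powr p) \<partial>P)
          \<le> ennreal ((gronwall_const (p * \<nu>) + 1) powr (1 / \<nu>))
            * powr_ennreal (\<integral>\<^sup>+ \<omega>. exp_ennreal (ennreal (p * \<mu>) * time_integral (\<lambda>s. \<psi> s \<omega>) T) \<partial>P) (1 / \<mu>)
            * powr_ennreal (\<integral>\<^sup>+ \<omega>. ennreal (running_sup H T \<omega> powr (p * \<nu>)) \<partial>P) (1 / \<nu>)"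
    (is "_ \<le> ennreal ?C * powr_ennreal ?E _ * powr_ennreal ?A _")
proof -
  let ?TI = "\<lambda>\<omega>. time_integral (\<lambda>s. \<psi> s \<omega>) T"
  have [measurable]: "?TI \<in> borel_measurable P"
    by (rule measurable_F_P[OF time_integral_measurable(1)[OF \<psi>(2) T]])
  note [measurable] = sup_discounted_measurable[OF T] exp_ennreal_measurable
  have p\<nu>0: "0 < p * \<nu>" using p exps by simp
  have c: "0 < gronwall_const (p * \<nu>) + 1" using gronwall_const_pos[OF p\<nu>0 p\<nu>] by simp
  show ?thesis
  proof (cases "AE \<omega> in P. ?TI \<omega> < \<infinity>")
    case True
    let ?f = "\<lambda>\<omega>. exp (p * enn2real (?TI \<omega>))"
    have "(\<integral>\<^sup>+ \<omega>. ennreal (SUP s\<in>{0..T}. Z s \<omega> powr p) \<partial>P) \<le> (\<integral>\<^sup>+ \<omega>. ennreal (?f \<omega> * sup_discounted T \<omega> powr p) \<partial>P)"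
      by (rule nn_integral_mono_AE) (use True AE_space in eventually_elim, intro ennreal_leI sup_Z_le T p)
    also have "\<dots> \<le> powr_ennreal (\<integral>\<^sup>+ \<omega>. ennreal (?f \<omega> powr \<mu>) \<partial>P) (1 / \<mu>)
       * powr_ennreal (\<integral>\<^sup>+ \<omega>. ennreal ((sup_discounted T \<omega> powr p) powr \<nu>) \<partial>P) (1 / \<nu>)"
      by (rule nn_integral_Holder) (use exps in auto)
    also have "(\<integral>\<^sup>+ \<omega>. ennreal (?f \<omega> powr \<mu>) \<partial>P) = ?E"
    proof (rule nn_integral_cong_AE)
      show "AE \<omega> in P. ennreal (?f \<omega> powr \<mu>) = exp_ennreal (ennreal (p * \<mu>) * ?TI \<omega>)"
        using True
      proof eventually_elim
        case (elim \<omega>)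
        then obtain r where r: "?TI \<omega> = ennreal r" "0 \<le> r" by (cases "?TI \<omega>") auto
        have "exp_ennreal (ennreal (p * \<mu>) * ?TI \<omega>) = ennreal (exp (p * \<mu> * r))"
          using r p exps by (simp add: exp_ennreal_ennreal flip: ennreal_mult)
        then show ?case using r by (simp add: exp_powr_real mult_ac)
      qed
    qed
    also have "powr_ennreal ?E (1 / \<mu>) * powr_ennreal (\<integral>\<^sup>+ \<omega>. ennreal ((sup_discounted T \<omega> powr p) powr \<nu>) \<partial>P) (1 / \<nu>)
      \<le> powr_ennreal ?E (1 / \<mu>) * powr_ennreal (ennreal (gronwall_const (p * \<nu>) + 1) * ?A) (1 / \<nu>)"
      using sup_discounted_moment[OF T True p\<nu>0 p\<nu>] exps
      by (intro mult_left_mono powr_ennreal_mono) (auto simp: powr_powr)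
    also have "\<dots> = ennreal ?C * powr_ennreal ?E (1 / \<mu>) * powr_ennreal ?A (1 / \<nu>)"
      unfolding powr_ennreal_mult[OF c] by (simp only: mult_ac)
    finally show ?thesis .
  next
    case False
    \<comment> \<open>If the integral of \<open>\<psi>\<close> is not almost surely finite, the
      exponential moment is infinite. A nonzero moment of \<open>H\<^sup>*\<close> makes the whole
      right-hand side infinite rather than \<open>\<infinity> * 0\<close>.\<close>
    then have A: "?A \<noteq> 0" using cond by blast
    have E: "?E = \<infinity>"
    proof (rule ccontr)
      assume "?E \<noteq> \<infinity>"
      then have "AE \<omega> in P. exp_ennreal (ennreal (p * \<mu>) * ?TI \<omega>) \<noteq> \<infinity>"
        by (intro nn_integral_PInf_AE) measurable
      then have "AE \<omega> in P. ?TI \<omega> < \<infinity>"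
      proof eventually_elim
        case (elim \<omega>)
        have "exp_ennreal (ennreal (p * \<mu>) * ?TI \<omega>) = \<infinity>" if "?TI \<omega> = \<infinity>"
          using p exps that by (simp add: exp_ennreal_def ennreal_mult_top)
        then show ?case using elim by (metis infinity_ennreal_def top.not_eq_extremum)
      qed
      with False show False ..
    qed
    have "0 < ?C" using c by simp
    then have "ennreal ?C * powr_ennreal ?E (1 / \<mu>) * powr_ennreal ?A (1 / \<nu>) = \<infinity>"
    proof -
      have "powr_ennreal ?E (1 / \<mu>) = \<top>" unfolding E by (simp add: powr_ennreal_def)
      moreover have "powr_ennreal ?A (1 / \<nu>) \<noteq> 0" "ennreal ?C \<noteq> 0"
        using A \<open>0 < ?C\<close> by (simp_all only: powr_ennreal_eq_0_iff ennreal_eq_0_iff not_le not_False_eq_True)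
      ultimately show ?thesis by (simp only: ennreal_mult_eq_top_iff infinity_ennreal_def simp_thms)
    qed
    then show ?thesis by simp
  qed
qed

text \<open>A deterministic discount is a constant factor and leaves the integral directly, so the
  exponent \<open>p\<close> is kept and no Hoelder loss occurs. If the integral of \<open>g\<close>
  is infinite, the right-hand sides are infinite, because the condition excludes a vanishing moment
  of \<open>H\<^sup>*\<close>.\<close>

lemma deterministic_bounds:
  assumes g: "\<And>\<omega> s. \<omega> \<in> space P \<Longrightarrow> 0 \<le> s \<Longrightarrow> \<psi> s \<omega> = g s" and T: "0 \<le> T"
  shows "0 < p \<Longrightarrow> p < 1 \<Longrightarrow> time_integral g T < \<infinity> \<or> (\<integral>\<^sup>+ \<omega>. ennreal (running_sup H T \<omega> powr p) \<partial>P) \<noteq> 0 \<Longrightarrow>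
      (\<integral>\<^sup>+ \<omega>. ennreal (SUP s\<in>{0..T}. Z s \<omega> powr p) \<partial>P)
        \<le> ennreal (gronwall_const p + 1) * exp_ennreal (ennreal p * time_integral g T)
           * (\<integral>\<^sup>+ \<omega>. ennreal (running_sup H T \<omega> powr p) \<partial>P)"
    and "time_integral g T < \<infinity> \<or> (\<integral>\<^sup>+ \<omega>. ennreal (running_sup H T \<omega>) \<partial>P) \<noteq> 0 \<Longrightarrow>
      (\<integral>\<^sup>+ \<omega>. ennreal (Z T \<omega>) \<partial>P)
        \<le> exp_ennreal (time_integral g T) * (\<integral>\<^sup>+ \<omega>. ennreal (running_sup H T \<omega>) \<partial>P)"
proof -
  have TI: "time_integral (\<lambda>s. \<psi> s \<omega>) T = time_integral g T" if "\<omega> \<in> space P" for \<omega>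
    unfolding time_integral_def using g[OF that] by (intro nn_integral_cong) (auto simp: indicator_def)
  have fin: "AE \<omega> in P. time_integral (\<lambda>s. \<psi> s \<omega>) T < \<infinity>" if "time_integral g T < \<infinity>"
    using that TI by (intro AE_I2) simp
  note [measurable] = sup_discounted_measurable[OF T] measurable_F_P[OF discounted_measurable[OF T]]
  show "(\<integral>\<^sup>+ \<omega>. ennreal (SUP s\<in>{0..T}. Z s \<omega> powr p) \<partial>P)
        \<le> ennreal (gronwall_const p + 1) * exp_ennreal (ennreal p * time_integral g T)
           * (\<integral>\<^sup>+ \<omega>. ennreal (running_sup H T \<omega> powr p) \<partial>P)" (is "_ \<le> ennreal ?C * _ * ?A")
    if p: "0 < p" "p < 1" and cond: "time_integral g T < \<infinity> \<or> (\<integral>\<^sup>+ \<omega>. ennreal (running_sup H T \<omega> powr p) \<partial>P) \<noteq> 0"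
  proof (cases "time_integral g T < \<infinity>")
    case True
    then obtain r where r: "time_integral g T = ennreal r" "0 \<le> r" by (cases "time_integral g T") auto
    have E: "exp_ennreal (ennreal p * time_integral g T) = ennreal (exp (p * r))"
      using r p by (simp add: exp_ennreal_ennreal flip: ennreal_mult)
    have "(\<integral>\<^sup>+ \<omega>. ennreal (SUP s\<in>{0..T}. Z s \<omega> powr p) \<partial>P) \<le> (\<integral>\<^sup>+ \<omega>. ennreal (exp (p * r)) * ennreal (sup_discounted T \<omega> powr p) \<partial>P)"
    proof (rule nn_integral_mono)
      fix \<omega> assume \<omega>: "\<omega> \<in> space P"
      show "ennreal (SUP s\<in>{0..T}. Z s \<omega> powr p) \<le> ennreal (exp (p * r)) * ennreal (sup_discounted T \<omega> powr p)"
        using sup_Z_le[OF \<omega> T _ p(1)] True r by (simp add: TI[OF \<omega>] ennreal_leI flip: ennreal_mult)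
    qed
    also have "\<dots> = ennreal (exp (p * r)) * (\<integral>\<^sup>+ \<omega>. ennreal (sup_discounted T \<omega> powr p) \<partial>P)"
      by (rule nn_integral_cmult) measurable
    also have "\<dots> \<le> ennreal (exp (p * r)) * (ennreal ?C * ?A)"
      by (intro mult_left_mono sup_discounted_moment T fin True p) simp
    finally show ?thesis by (simp add: E mult_ac)
  next
    case False
    then have "time_integral g T = \<infinity>" by (metis infinity_ennreal_def top.not_eq_extremum)
    then have "exp_ennreal (ennreal p * time_integral g T) = \<infinity>"
      using p by (simp add: exp_ennreal_def ennreal_mult_top)
    moreover have "0 < ?C" using gronwall_const_pos[OF p] by simp
    ultimately have "ennreal ?C * exp_ennreal (ennreal p * time_integral g T) * ?A = \<infinity>"
      using cond False by (simp add: ennreal_mult_top ennreal_top_mult)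
    then show ?thesis by simp
  qed
  show "(\<integral>\<^sup>+ \<omega>. ennreal (Z T \<omega>) \<partial>P)
        \<le> exp_ennreal (time_integral g T) * (\<integral>\<^sup>+ \<omega>. ennreal (running_sup H T \<omega>) \<partial>P)"
    if cond: "time_integral g T < \<infinity> \<or> (\<integral>\<^sup>+ \<omega>. ennreal (running_sup H T \<omega>) \<partial>P) \<noteq> 0"
  proof (cases "time_integral g T < \<infinity>")
    case True
    then obtain r where r: "time_integral g T = ennreal r" "0 \<le> r" by (cases "time_integral g T") auto
    have "(\<integral>\<^sup>+ \<omega>. ennreal (Z T \<omega>) \<partial>P) = (\<integral>\<^sup>+ \<omega>. ennreal (exp r) * ennreal (discounted T \<omega>) \<partial>P)"
      using r discounted_nonneg[OF _ T] by (intro nn_integral_cong) (simp add: Z_eq[of T] TI flip: ennreal_mult)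
    also have "\<dots> = ennreal (exp r) * (\<integral>\<^sup>+ \<omega>. ennreal (discounted T \<omega>) \<partial>P)"
      by (rule nn_integral_cmult) measurable
    also have "\<dots> \<le> ennreal (exp r) * (\<integral>\<^sup>+ \<omega>. ennreal (running_sup H T \<omega>) \<partial>P)"
      by (intro mult_left_mono expectation_discounted T fin True) simp
    finally show ?thesis using r by (simp add: exp_ennreal_ennreal)
  next
    case False
    then have "exp_ennreal (time_integral g T) = \<infinity>" by (simp add: exp_ennreal_def less_top)
    then show ?thesis using cond False by (simp add: ennreal_top_mult)
  qed
qed

end

theorem theorem4:
  fixes P :: "'a measure" and F :: "real \<Rightarrow> 'a measure"
    and Z H \<psi> M :: "real \<Rightarrow> 'a \<Rightarrow> real"
  assumes "filtered_prob_space P F"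
    and "nonneg_process P Z" and "adapted F Z" and "continuous_paths P Z"
    and "nonneg_process P H" and "adapted F H" and "continuous_paths P H"
    and "nonneg_process P \<psi>" and "progressively_measurable F \<psi>"
    and "continuous_local_martingale P F M" and "AE \<omega> in P. M 0 \<omega> = 0"
    and "AE \<omega> in P. \<forall>t\<ge>0. ereal (Z t \<omega>)
           \<le> enn2ereal (time_integral (\<lambda>s. \<psi> s \<omega> * Z s \<omega>) t) + ereal (M t \<omega>) + ereal (H t \<omega>)"
  shows
    "(\<forall>p \<mu> \<nu> t. 0 < p \<and> p < 1 \<and> 1 < \<mu> \<and> 1 < \<nu> \<and> 1 / \<mu> + 1 / \<nu> = 1 \<and> p * \<nu> < 1 \<and> 0 \<le> t \<and>
        ((AE \<omega> in P. time_integral (\<lambda>s. \<psi> s \<omega>) t < \<infinity>) \<or>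
         (\<integral>\<^sup>+ \<omega>. ennreal (running_sup H t \<omega> powr (p * \<nu>)) \<partial>P) \<noteq> 0) \<longrightarrow>
        (\<integral>\<^sup>+ \<omega>. ennreal (SUP s\<in>{0..t}. Z s \<omega> powr p) \<partial>P)
          \<le> ennreal ((gronwall_const (p * \<nu>) + 1) powr (1 / \<nu>))
            * powr_ennreal (\<integral>\<^sup>+ \<omega>. exp_ennreal (ennreal (p * \<mu>) * time_integral (\<lambda>s. \<psi> s \<omega>) t) \<partial>P) (1 / \<mu>)
            * powr_ennreal (\<integral>\<^sup>+ \<omega>. ennreal (running_sup H t \<omega> powr (p * \<nu>)) \<partial>P) (1 / \<nu>))
     \<and> (\<forall>g. (\<forall>\<omega>\<in>space P. \<forall>s\<ge>0. \<psi> s \<omega> = g s) \<longrightarrow>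
          (\<forall>p t. 0 < p \<and> p < 1 \<and> 0 \<le> t \<and>
             (time_integral g t < \<infinity> \<or> (\<integral>\<^sup>+ \<omega>. ennreal (running_sup H t \<omega> powr p) \<partial>P) \<noteq> 0) \<longrightarrow>
             (\<integral>\<^sup>+ \<omega>. ennreal (SUP s\<in>{0..t}. Z s \<omega> powr p) \<partial>P)
               \<le> ennreal (gronwall_const p + 1) * exp_ennreal (ennreal p * time_integral g t)
                 * (\<integral>\<^sup>+ \<omega>. ennreal (running_sup H t \<omega> powr p) \<partial>P))
        \<and> (\<forall>t. 0 \<le> t \<and>
             (time_integral g t < \<infinity> \<or> (\<integral>\<^sup>+ \<omega>. ennreal (running_sup H t \<omega>) \<partial>P) \<noteq> 0) \<longrightarrow>
             (\<integral>\<^sup>+ \<omega>. ennreal (Z t \<omega>) \<partial>P)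
               \<le> exp_ennreal (time_integral g t) * (\<integral>\<^sup>+ \<omega>. ennreal (running_sup H t \<omega>) \<partial>P)))"
proof -
  interpret stochastic_gronwall P F Z H \<psi> M
    by (intro stochastic_gronwall.intro stochastic_gronwall_axioms.intro) (fact assms)+
  show ?thesis
  proof (intro conjI allI impI, goal_cases)
    case (1 p \<mu> \<nu> t)
    then show ?case by (intro random_bound) simp_all
  next
    case (2 g p t)
    then show ?case by (intro deterministic_bounds(1)) simp_all
  next
    case (3 g t)
    then show ?case by (intro deterministic_bounds(2)) simp_all
  qed
qed

end
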